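(* Let $\Phi$ be a homogeneous Poisson point process of intensity $\lambda>0$ on $\mathbb{R}^2$, and for $\theta\in(0,2\pi)$ let $\Psi_\theta$ be the set of all points $Z$ that lie on some one-dimensional facet $S$ of the Voronoi tessellation of $\Phi$ and satisfy $\widehat{D_1,Z,D_2}=\theta \pmod{2\pi}$, where $D_1<D_2$ are the two ordered Delaunay neighbors associated with $S$. Then for all $\theta\in(0,2\pi)$, $\Psi_\theta$ is a stationary and ergodic point process on $\mathbb{R}^2$, and its intensity $\gamma_\theta$ is equal to $2\lambda\sin^2\frac{\theta}{2}$.
   Context: The Voronoi cell of $X\in\Phi$ is $\mathcal{V}_X=\{x\in\mathbb{R}^2:\ \|x-X\|\le \inf_{Y\in\Phi\setminus\{X\}}\|x-Y\|\}$. Almost surely all cells are bounded polygons; the one-dimensional facets of the tessellation are the segments (of positive length) of the form $\mathcal{V}_X\cap\mathcal{V}_Y$ with $X\neq Y$ in $\Phi$. The two points $X,Y$ are called the Delaunay neighbors (or Delaunay pair) associated with the facet. Pairs of points of $\mathbb{R}^2$ are ordered by a fixed intrinsic order, namely the natural order on the $x$-coordinate (almost surely no two points of $\Phi$ share the same $x$-coordinate); $D<D'$ refers to this order. For $D<D'$ and $Z\in\mathbb{R}^2$, $\widehat{D,Z,D'}$ denotes the oriented angle from $D$ to $D'$ as seen from the origin $Z$, measured in the anti-trigonometric (clockwise) direction, taken modulo $2\pi$. The intensity of a stationary point process on $\mathbb{R}^2$ is its mean number of points per unit area. *)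

theory Defs
  imports "HOL-Probability.Probability" "HOL-Library.Real_Mod"
begin

type_synonym plane = "real ^ 2"

section \<open>Point processes on the plane\<close>

definition locally_finite_sets :: "plane set set" where
  "locally_finite_sets = {A. \<forall>B. bounded B \<longrightarrow> finite (A \<inter> B)}"

text \<open>The space of simple point configurations, with the sigma-algebra generated by the counts
  in bounded Borel sets. A (simple) point process is a random element of it.\<close>

definition configurations :: "plane set measure" where
  "configurations = sigma locally_finite_sets
     {{A \<in> locally_finite_sets. card (A \<inter> B) = n} | B n. B \<in> sets borel \<and> bounded B}"

definition point_process :: "'w measure \<Rightarrow> ('w \<Rightarrow> plane set) \<Rightarrow> bool" where
  "point_process M \<Phi> \<longleftrightarrow> prob_space M \<and> \<Phi> \<in> measurable M configurations"

definition shift :: "plane \<Rightarrow> plane set \<Rightarrow> plane set" where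
  "shift t A = (\<lambda>x. x + t) ` A"

definition stationary :: "'w measure \<Rightarrow> ('w \<Rightarrow> plane set) \<Rightarrow> bool" where
  "stationary M \<Phi> \<longleftrightarrow>
     (\<forall>t. distr M configurations (\<lambda>\<omega>. shift t (\<Phi> \<omega>)) = distr M configurations \<Phi>)"

text \<open>Ergodicity: every shift-invariant event of configurations is trivial.\<close>

definition ergodic :: "'w measure \<Rightarrow> ('w \<Rightarrow> plane set) \<Rightarrow> bool" where
  "ergodic M \<Phi> \<longleftrightarrow>
     (\<forall>E \<in> sets configurations. (\<forall>t. shift t ` E = E) \<longrightarrow>
        measure (distr M configurations \<Phi>) E \<in> {0, 1})"

text \<open>For a stationary process the mean number of points per unit area is the mean number of
  points in any fixed Borel set of area one; we take the unit square. A priori it may be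
  infinite.\<close>

definition intensity :: "'w measure \<Rightarrow> ('w \<Rightarrow> plane set) \<Rightarrow> ennreal" where
  "intensity M \<Phi> = (\<integral>\<^sup>+ \<omega>. of_nat (card (\<Phi> \<omega> \<inter> cbox 0 1)) \<partial>M)"

text \<open>The Poisson probabilities are written out because the library's Poisson distribution
  requires a positive rate, whereas \<open>B\<close> may have area zero.\<close>

definition homogeneous_poisson_process ::
    "'w measure \<Rightarrow> real \<Rightarrow> ('w \<Rightarrow> plane set) \<Rightarrow> bool" where
  "homogeneous_poisson_process M l \<Phi> \<longleftrightarrow>
     point_process M \<Phi> \<and>
     (\<forall>B n. B \<in> sets borel \<and> bounded B \<longrightarrow>
        measure M {\<omega> \<in> space M. card (\<Phi> \<omega> \<inter> B) = n} =
          (l * measure lborel B) ^ n / fact n * exp (- (l * measure lborel B))) \<and>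
     (\<forall>k (B :: nat \<Rightarrow> plane set).
        (\<forall>i<k. B i \<in> sets borel \<and> bounded (B i)) \<and> disjoint_family_on B {..<k} \<longrightarrow>
        prob_space.indep_vars M (\<lambda>_. count_space UNIV) (\<lambda>i \<omega>. card (\<Phi> \<omega> \<inter> B i)) {..<k})"

section \<open>Voronoi facets and points seeing a Delaunay pair under a given angle\<close>

text \<open>The infimum is taken in the extended reals, so that it is infinite over the empty set.\<close>

definition voronoi_cell :: "plane set \<Rightarrow> plane \<Rightarrow> plane set" where
  "voronoi_cell \<phi> X =
     {x. ereal (norm (x - X)) \<le> (INF Y \<in> \<phi> - {X}. ereal (norm (x - Y)))}"

definition voronoi_facet :: "plane set \<Rightarrow> plane \<Rightarrow> plane \<Rightarrow> plane set \<Rightarrow> bool" where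
  "voronoi_facet \<phi> X Y S \<longleftrightarrow>
     X \<in> \<phi> \<and> Y \<in> \<phi> \<and> X \<noteq> Y \<and> S = voronoi_cell \<phi> X \<inter> voronoi_cell \<phi> Y \<and>
     (\<exists>a b. a \<noteq> b \<and> S = closed_segment a b)"

definition to_complex :: "plane \<Rightarrow> complex" where
  "to_complex v = Complex (v $ 1) (v $ 2)"

text \<open>A clockwise rotation from \<open>D - Z\<close> to \<open>D' - Z\<close> is a counterclockwise one from
  \<open>D' - Z\<close> to \<open>D - Z\<close>; its angle, in \<open>[0, 2 * pi)\<close>, is the argument of the quotient below.\<close>

definition cw_angle :: "plane \<Rightarrow> plane \<Rightarrow> plane \<Rightarrow> real" where
  "cw_angle D Z D' = Arg2pi (to_complex (D - Z) / to_complex (D' - Z))"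

text \<open>Pairs are ordered by their first coordinate; the order on type \<open>real ^ 2\<close>
  is componentwise and hence not the intended one.\<close>

definition angle_points :: "real \<Rightarrow> plane set \<Rightarrow> plane set" where
  "angle_points \<theta> \<phi> =
     {Z. \<exists>S D1 D2. voronoi_facet \<phi> D1 D2 S \<and> D1 $ 1 < D2 $ 1 \<and> Z \<in> S \<and>
           [cw_angle D1 Z D2 = \<theta>] (rmod (2 * pi))}"

end

theory Submission
  imports Defs
begin

text \<open>
  Configurations are simple, so the void events \<open>\<phi> \<inter> B = {}\<close> form an intersection-stable generator of their
  sigma-algebra, and a law is determined by its void probabilities; for the Poisson process these are
  \<open>exp (- l * area B)\<close>. This gives invariance under translations and independence over disjoint windows,
  hence ergodicity, and also the Mecke formula. The map \<open>angle_points \<theta>\<close> is measurable and commutes with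
  translations, so it inherits stationarity and ergodicity.

  For the intensity, put \<open>q = cis (-\<theta>)\<close>. The only point seeing a pair \<open>X\<close>, \<open>Y\<close> at equal distances under the angle
  \<open>\<theta>\<close> is \<open>Z = (Y - q X) / (1 - q)\<close>, and almost surely it counts iff no other point lies in the disk about \<open>Z\<close>
  through \<open>X\<close>. By the Mecke formula the intensity is \<open>l^2\<close> times the integral of \<open>exp (- l pi |Z - X|^2)\<close> over the
  pairs with \<open>X $ 1 < Y $ 1\<close> and \<open>Z\<close> in the unit square. Passing from \<open>Y\<close> to \<open>Z\<close> produces the Jacobian
  \<open>|1 - q|^2 = 4 sin^2 (\<theta> / 2)\<close>, and what remains is half of a Gaussian integral, \<open>1 / (2 l)\<close>.
\<close>


section \<open>The sigma-algebra of configurations\<close>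

text \<open>The event that the apex of a pair really counts involves its facet, with positive length
  and boundedness. The count is therefore squeezed between two sums over pairs. With the two points
  removed, emptiness of the open disk is necessary; emptiness of the closed disk, together with
  failure of \<open>nearest\<close> somewhere on each ray of the bisector, is sufficient. The circle
  has area zero and failure on both rays is almost sure, so the two sums have the same mean: further
  points on the circle and unbounded facets are absorbed in the gap.

  The computations use the law on the space of configurations, and one input about it: the joint
  probability of a count over a bounded set and a void over a disjoint one. An empty first set gives
  the void probabilities, additivity of area then gives independence, and general counts give the
  Mecke formula on products of a bounded set and a void event, which form an intersection-stable
  generator. The formula is used in its reduced form, with the point removed, since emptiness of the
  disk concerns only the points other than \<open>X\<close> and \<open>Y\<close>.\<close>

definition void_event :: "plane set \<Rightarrow> plane set set" where
  "void_event B = {\<phi> \<in> locally_finite_sets. \<phi> \<inter> B = {}}"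

lemma space_configurations: "space configurations = locally_finite_sets"
  unfolding configurations_def by (rule space_measure_of) auto

lemma sets_configurations:
  "sets configurations = sigma_sets locally_finite_sets
     {{A \<in> locally_finite_sets. card (A \<inter> B) = n} | B n. B \<in> sets borel \<and> bounded B}"
  unfolding configurations_def by (rule sets_measure_of) auto

lemma locally_finiteD: "\<phi> \<in> locally_finite_sets \<Longrightarrow> bounded B \<Longrightarrow> finite (\<phi> \<inter> B)"
  by (auto simp: locally_finite_sets_def)

lemma locally_finite_subset: "\<phi> \<in> locally_finite_sets \<Longrightarrow> \<psi> \<subseteq> \<phi> \<Longrightarrow> \<psi> \<in> locally_finite_sets"
  unfolding locally_finite_sets_def
proof clarify
  fix B :: "plane set" assume *: "\<forall>B. bounded B \<longrightarrow> finite (\<phi> \<inter> B)" "\<psi> \<subseteq> \<phi>" "bounded B"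
  from * have "finite (\<phi> \<inter> B)" by simp
  with *(2) show "finite (\<psi> \<inter> B)" by (meson Int_mono finite_subset order.refl)
qed

text \<open>Finitely many points have disjoint basic neighbourhoods, at radii below half their
  separation. Conversely, points chosen from disjoint sets are distinct. With a countable basis the
  right side is a countable union.\<close>

lemma card_ge_iff_disjoint_basic_sets:
  fixes A :: "'a::metric_space set"
  assumes "finite A" "topological_basis \<B>"
  shows "n \<le> card A \<longleftrightarrow>
    (\<exists>F. F \<subseteq> \<B> \<and> finite F \<and> card F = n \<and> disjoint F \<and> (\<forall>U\<in>F. A \<inter> U \<noteq> {}))"
proof
  assume "n \<le> card A"
  then obtain T where T: "T \<subseteq> A" "card T = n" "finite T"
    using obtain_subset_with_card_n by (metis assms(1) finite_subset)
  have "\<forall>a\<in>T. \<exists>d>0. \<forall>x\<in>T. x \<noteq> a \<longrightarrow> d \<le> dist a x"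
    using finite_set_avoid[OF \<open>finite T\<close>] by blast
  then obtain d where d: "\<And>a. a \<in> T \<Longrightarrow> d a > 0"
      "\<And>a x. a \<in> T \<Longrightarrow> x \<in> T \<Longrightarrow> x \<noteq> a \<Longrightarrow> d a \<le> dist a x" by metis
  have "\<forall>a\<in>T. \<exists>U\<in>\<B>. a \<in> U \<and> U \<subseteq> ball a (d a / 2)"
    using topological_basisE[OF assms(2) open_ball] d(1)
    by (metis centre_in_ball half_gt_zero)
  then obtain U where U: "\<And>a. a \<in> T \<Longrightarrow> U a \<in> \<B>" "\<And>a. a \<in> T \<Longrightarrow> a \<in> U a"
      "\<And>a. a \<in> T \<Longrightarrow> U a \<subseteq> ball a (d a / 2)" by metis
  have disj: "U a \<inter> U b = {}" if "a \<in> T" "b \<in> T" "a \<noteq> b" for a b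
  proof (rule ccontr)
    assume "U a \<inter> U b \<noteq> {}"
    then obtain z where "z \<in> U a" "z \<in> U b" by auto
    then have "dist a z < d a / 2" "dist b z < d b / 2" using U(3) that by force+
    moreover have "d a \<le> dist a b" "d b \<le> dist a b"
      using d(2)[of a b] d(2)[of b a] that by (auto simp: dist_commute)
    moreover have "dist a b \<le> dist a z + dist b z"
      by (metis dist_commute dist_triangle)
    ultimately show False by linarith
  qed
  have "inj_on U T"
    using disj U(2) by (metis IntI empty_iff inj_onI)
  then have "card (U ` T) = n" using T by (simp add: card_image)
  moreover have "disjoint (U ` T)"
    unfolding disjoint_def using disj by blast
  moreover have "\<forall>V\<in>U ` T. A \<inter> V \<noteq> {}" using U(2) T(1) by blast
  moreover have "U ` T \<subseteq> \<B>" using U(1) by blast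
  ultimately show "\<exists>F. F \<subseteq> \<B> \<and> finite F \<and> card F = n \<and> disjoint F \<and> (\<forall>U\<in>F. A \<inter> U \<noteq> {})"
    using T(3) by blast
next
  assume "\<exists>F. F \<subseteq> \<B> \<and> finite F \<and> card F = n \<and> disjoint F \<and> (\<forall>U\<in>F. A \<inter> U \<noteq> {})"
  then obtain F where F: "finite F" "card F = n" "disjoint F" "\<And>U. U \<in> F \<Longrightarrow> A \<inter> U \<noteq> {}"
    by auto
  then have "\<forall>U\<in>F. \<exists>x. x \<in> A \<inter> U" by blast
  then obtain p where "\<forall>U\<in>F. p U \<in> A \<inter> U" using bchoice by meson
  then have p: "\<And>U. U \<in> F \<Longrightarrow> p U \<in> A" "\<And>U. U \<in> F \<Longrightarrow> p U \<in> U" by auto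
  have "inj_on p F"
    using F(3) p(2) unfolding disjoint_def by (metis IntI empty_iff inj_onI)
  then show "n \<le> card A"
    using card_inj_on_le[of p F A] p(1) F(2) assms(1) by blast
qed

lemma void_event_sets: "B \<in> sets borel \<Longrightarrow> bounded B \<Longrightarrow> void_event B \<in> sets configurations"
proof -
  assume B: "B \<in> sets borel" "bounded B"
  have "void_event B = {A \<in> locally_finite_sets. card (A \<inter> B) = 0}"
    using B(2) by (auto simp: void_event_def locally_finiteD)
  then show ?thesis
    unfolding sets_configurations using B by (auto intro!: sigma_sets.Basic)
qed

text \<open>Simplicity of the configurations enters here: a count is at least \<open>n\<close> iff \<open>n\<close> disjoint
  basic open sets are hit, so that counting events are countable combinations of void events.\<close>

lemma sets_configurations_void:
  "sets configurations =
     sigma_sets locally_finite_sets {void_event B | B. B \<in> sets borel \<and> bounded B}" (is "_ = ?S")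
proof
  show "?S \<subseteq> sets configurations"
    unfolding space_configurations[symmetric]
    by (rule sets.sigma_sets_subset) (auto intro: void_event_sets)
  interpret S: sigma_algebra locally_finite_sets ?S
    by (rule sigma_algebra_sigma_sets) (auto simp: void_event_def)
  obtain \<B> :: "plane set set" where \<B>: "countable \<B>" "topological_basis \<B>"
    using ex_countable_basis by blast
  have ge: "{A \<in> locally_finite_sets. n \<le> card (A \<inter> B)} \<in> ?S"
    if B: "B \<in> sets borel" "bounded B" for B and n :: nat
  proof -
    let ?FF = "{F. F \<subseteq> \<B> \<and> finite F \<and> card F = n \<and> disjoint F}"
    have "{A \<in> locally_finite_sets. n \<le> card (A \<inter> B)} =
        (\<Union>F\<in>?FF. {A \<in> locally_finite_sets. \<forall>U\<in>F. A \<inter> B \<inter> U \<noteq> {}})"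
      using card_ge_iff_disjoint_basic_sets[OF locally_finiteD[OF _ B(2)] \<B>(2)] by fastforce
    also have "\<dots> \<in> ?S"
    proof (rule S.countable_UN')
      have "countable {F. F \<subseteq> \<B> \<and> finite F}"
        using countable_Collect_finite_subset[OF \<B>(1)] by (simp add: conj_commute)
      then show "countable ?FF"
        by (rule countable_subset[rotated]) auto
      show "(\<lambda>F. {A \<in> locally_finite_sets. \<forall>U\<in>F. A \<inter> B \<inter> U \<noteq> {}}) ` ?FF \<subseteq> ?S"
      proof clarify
        fix F assume F: "F \<subseteq> \<B>" "finite F"
        have "{A \<in> locally_finite_sets. A \<inter> B \<inter> U \<noteq> {}} \<in> ?S" if "U \<in> F" for U
        proof -
          have "open U" using that F(1) \<B>(2) topological_basis_open by blast
          then have "void_event (B \<inter> U) \<in> ?S"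
            using B by (intro sigma_sets.Basic) (auto intro: bounded_Int)
          moreover have "{A \<in> locally_finite_sets. A \<inter> B \<inter> U \<noteq> {}} =
              locally_finite_sets - void_event (B \<inter> U)"
            by (auto simp: void_event_def)
          ultimately show ?thesis using S.compl_sets by simp
        qed
        then show "{A \<in> locally_finite_sets. \<forall>U\<in>F. A \<inter> B \<inter> U \<noteq> {}} \<in> ?S"
          using F(2) by (intro S.sets_Collect_finite_All) auto
      qed
    qed
    finally show ?thesis .
  qed
  show "sets configurations \<subseteq> ?S"
    unfolding sets_configurations
  proof (rule S.sigma_sets_subset, clarify)
    fix B :: "plane set" and n assume B: "B \<in> sets borel" "bounded B"
    have "{A \<in> locally_finite_sets. card (A \<inter> B) = n} =
        {A \<in> locally_finite_sets. n \<le> card (A \<inter> B)} - {A \<in> locally_finite_sets. Suc n \<le> card (A \<inter> B)}"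
      by auto
    also have "\<dots> \<in> ?S" using ge[OF B, of n] ge[OF B, of "Suc n"] by (rule S.Diff)
    finally show "{A \<in> locally_finite_sets. card (A \<inter> B) = n} \<in> ?S" .
  qed
qed

lemma Int_stable_void_events: "Int_stable {void_event B | B. B \<in> sets borel \<and> bounded B}"
proof (rule Int_stableI, clarify)
  fix B C :: "plane set" assume "B \<in> sets borel" "bounded B" "C \<in> sets borel" "bounded C"
  moreover have "void_event B \<inter> void_event C = void_event (B \<union> C)"
    by (auto simp: void_event_def)
  ultimately show "\<exists>D. void_event B \<inter> void_event C = void_event D \<and> D \<in> sets borel \<and> bounded D"
    by (auto intro!: exI[of _ "B \<union> C"])
qed

text \<open>Void events generate, so measurability of a point map reduces to emptiness over bounded
  windows, a quantified statement about the points.\<close>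

lemma measurable_configurationsI:
  assumes "\<And>s. s \<in> space N \<Longrightarrow> f s \<in> locally_finite_sets"
    and "\<And>B. B \<in> sets borel \<Longrightarrow> bounded B \<Longrightarrow> {s \<in> space N. f s \<inter> B = {}} \<in> sets N"
  shows "f \<in> measurable N configurations"
proof (rule measurable_sigma_sets[OF sets_configurations_void])
  show "{void_event B | B. B \<in> sets borel \<and> bounded B} \<subseteq> Pow locally_finite_sets"
    by (auto simp: void_event_def)
  show "f \<in> space N \<rightarrow> locally_finite_sets" using assms(1) by auto
  fix y assume "y \<in> {void_event B | B. B \<in> sets borel \<and> bounded B}"
  then obtain B where B: "y = void_event B" "B \<in> sets borel" "bounded B" by auto
  have "f -` y \<inter> space N = {s \<in> space N. f s \<inter> B = {}}"
    using assms(1) by (auto simp: B(1) void_event_def)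
  then show "f -` y \<inter> space N \<in> sets N" using assms(2) B by simp
qed

section \<open>Measurability of sums and quantifiers over the points of a configuration\<close>

lemma measurable_card_Int [measurable (raw)]:
  assumes "\<Phi> \<in> measurable N configurations" "B \<in> sets borel" "bounded B"
  shows "(\<lambda>s. card (\<Phi> s \<inter> B)) \<in> measurable N (count_space UNIV)"
proof -
  have "(\<lambda>\<phi>. card (\<phi> \<inter> B)) \<in> measurable configurations (count_space UNIV)"
    using assms(2,3)
  proof (subst measurable_count_space_eq2_countable, safe)
    fix n
    have "{A \<in> locally_finite_sets. card (A \<inter> B) = n} \<in> sets configurations"
      unfolding sets_configurations using assms(2,3) by (auto intro!: sigma_sets.Basic)
    also have "{A \<in> locally_finite_sets. card (A \<inter> B) = n} = (\<lambda>\<phi>. card (\<phi> \<inter> B)) -` {n} \<inter> space configurations"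
      by (auto simp: space_configurations)
    finally show "(\<lambda>\<phi>. card (\<phi> \<inter> B)) -` {n} \<inter> space configurations \<in> sets configurations" .
  qed auto
  from measurable_compose[OF assms(1) this] show ?thesis .
qed

text \<open>A Dynkin argument starting from rectangles. The bounded window \<open>Q\<close> keeps
  the counts finite, so that the complement step may subtract them.\<close>

lemma emeasure_count_measurable:
  assumes \<Phi>: "\<Phi> \<in> measurable N configurations"
    and Q: "Q \<in> sets borel" "bounded Q" and A: "A \<in> sets (N \<Otimes>\<^sub>M borel)"
  shows "(\<lambda>s. emeasure (count_space UNIV) (\<Phi> s \<inter> Q \<inter> Pair s -` A)) \<in> borel_measurable N"
proof -
  have lf: "finite (\<Phi> s \<inter> Q)" if "s \<in> space N" for s
    using measurable_space[OF \<Phi> that] Q(2) by (simp add: space_configurations locally_finiteD)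
  have rect: "(\<lambda>s. emeasure (count_space UNIV) (\<Phi> s \<inter> Q \<inter> b)) \<in> borel_measurable N"
    if b: "b \<in> sets borel" for b
  proof -
    have "(\<lambda>s. of_nat (card (\<Phi> s \<inter> (Q \<inter> b))) :: ennreal) \<in> borel_measurable N"
      using Q b
      by (intro measurable_compose[OF measurable_card_Int[OF \<Phi>]]) (auto intro: bounded_Int)
    also have "(\<lambda>s. of_nat (card (\<Phi> s \<inter> (Q \<inter> b))) :: ennreal) \<in> borel_measurable N \<longleftrightarrow> ?thesis"
      using lf by (intro measurable_cong)
        (metis emeasure_count_space_finite Int_assoc finite_Int top_greatest)
    finally show ?thesis .
  qed
  have A: "A \<in> sigma_sets (space N \<times> space borel) {a \<times> b | a b. a \<in> sets N \<and> b \<in> sets borel}"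
    using A unfolding sets_pair_measure .
  show ?thesis
    using Int_stable_pair_measure_generator pair_measure_closed A
  proof (induction rule: sigma_sets_induct_disjoint)
    case (basic X)
    then obtain a b where X: "X = a \<times> b" "a \<in> sets N" "b \<in> sets borel" by auto
    have "(\<lambda>s. emeasure (count_space UNIV) (\<Phi> s \<inter> Q \<inter> Pair s -` X)) =
        (\<lambda>s. indicator a s * emeasure (count_space UNIV) (\<Phi> s \<inter> Q \<inter> b))"
      by (auto simp: X(1) fun_eq_iff split: split_indicator)
    then show ?case using rect[OF X(3)] X(2) by simp
  next
    case empty
    then show ?case by simp
  next
    case (compl X)
    have "(\<lambda>s. emeasure (count_space UNIV) (\<Phi> s \<inter> Q \<inter> UNIV) -
        emeasure (count_space UNIV) (\<Phi> s \<inter> Q \<inter> Pair s -` X)) \<in> borel_measurable N"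
      using compl(2) rect[of UNIV] by measurable
    also have "?this \<longleftrightarrow> (\<lambda>s. emeasure (count_space UNIV)
       (\<Phi> s \<inter> Q \<inter> Pair s -` (space N \<times> space borel - X))) \<in> borel_measurable N"
    proof (rule measurable_cong)
      fix s assume s: "s \<in> space N"
      have eq: "\<Phi> s \<inter> Q \<inter> Pair s -` (space N \<times> space borel - X) = \<Phi> s \<inter> Q \<inter> UNIV - \<Phi> s \<inter> Q \<inter> Pair s -` X"
        using s by auto
      have fin: "emeasure (count_space UNIV) (\<Phi> s \<inter> Q \<inter> Pair s -` X) \<noteq> \<infinity>"
        using lf[OF s] by simp
      show "emeasure (count_space UNIV) (\<Phi> s \<inter> Q \<inter> UNIV) -
          emeasure (count_space UNIV) (\<Phi> s \<inter> Q \<inter> Pair s -` X) =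
          emeasure (count_space UNIV) (\<Phi> s \<inter> Q \<inter> Pair s -` (space N \<times> space borel - X))"
        unfolding eq using fin by (subst emeasure_Diff[OF fin]) auto
    qed
    finally show ?case .
  next
    case (union X)
    have "emeasure (count_space UNIV) (\<Phi> s \<inter> Q \<inter> Pair s -` (\<Union>i. X i)) =
        (\<Sum>i. emeasure (count_space UNIV) (\<Phi> s \<inter> Q \<inter> Pair s -` X i))" for s
    proof (subst suminf_emeasure)
      show "disjoint_family (\<lambda>i. \<Phi> s \<inter> Q \<inter> Pair s -` X i)"
        using union(1) unfolding disjoint_family_on_def by blast
    qed (simp_all add: vimage_UN)
    then show ?case using union(3) by simp
  qed
qed

text \<open>Monotone class argument; for indicators the plane is exhausted by balls, because the
  preceding lemma only counts in a bounded window.\<close>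

lemma nn_integral_count_space_measurable:
  assumes \<Phi>: "\<Phi> \<in> measurable N configurations"
    and g: "(\<lambda>(s, x). g s x) \<in> borel_measurable (N \<Otimes>\<^sub>M borel)"
  shows "(\<lambda>s. \<integral>\<^sup>+x. g s x \<partial>count_space (\<Phi> s)) \<in> borel_measurable N"
proof -
  have "(\<lambda>s. \<integral>\<^sup>+x. h (s, x) \<partial>count_space (\<Phi> s)) \<in> borel_measurable N"
    if "h \<in> borel_measurable (N \<Otimes>\<^sub>M borel)" for h
    using that
  proof (induction rule: borel_measurable_induct)
    case (cong f g)
    have "(\<lambda>s. \<integral>\<^sup>+x. f (s, x) \<partial>count_space (\<Phi> s)) \<in> borel_measurable N \<longleftrightarrow>
      (\<lambda>s. \<integral>\<^sup>+x. g (s, x) \<partial>count_space (\<Phi> s)) \<in> borel_measurable N"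
      using cong(3) by (intro measurable_cong nn_integral_cong) (simp add: space_pair_measure)
    then show ?case using cong by simp
  next
    case (set A)
    have "(\<integral>\<^sup>+x. indicator A (s, x) \<partial>count_space (\<Phi> s)) =
        (SUP n. emeasure (count_space UNIV) (\<Phi> s \<inter> ball 0 (real n) \<inter> Pair s -` A))" for s
    proof -
      have "(\<integral>\<^sup>+x. indicator A (s, x) \<partial>count_space (\<Phi> s)) =
          (\<integral>\<^sup>+x. indicator (\<Phi> s \<inter> Pair s -` A) x \<partial>count_space UNIV)"
        by (subst nn_integral_count_space_indicator, simp, rule nn_integral_cong)
          (simp split: split_indicator)
      also have "\<dots> = emeasure (count_space UNIV) (\<Phi> s \<inter> Pair s -` A)"
        by (rule nn_integral_indicator) simp
      also have "\<Phi> s \<inter> Pair s -` A = (\<Union>n. \<Phi> s \<inter> ball 0 (real n) \<inter> Pair s -` A)"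
        using reals_Archimedean2 by auto
      also have "emeasure (count_space UNIV) \<dots> =
          (SUP n. emeasure (count_space UNIV) (\<Phi> s \<inter> ball 0 (real n) \<inter> Pair s -` A))"
        by (rule SUP_emeasure_incseq[symmetric]) (auto simp: incseq_def)
      finally show ?thesis .
    qed
    then show ?case
      using emeasure_count_measurable[OF \<Phi> _ _ set] by simp
  next
    case (mult u v)
    then show ?case by (simp add: nn_integral_cmult)
  next
    case (add u v)
    then show ?case by (simp add: nn_integral_add)
  next
    case (seq U)
    have "(\<integral>\<^sup>+x. (SUP i. U i) (s, x) \<partial>count_space (\<Phi> s)) =
        (SUP i. \<integral>\<^sup>+x. U i (s, x) \<partial>count_space (\<Phi> s))" for s
      using seq(3) unfolding SUP_apply
      by (intro nn_integral_monotone_convergence_SUP) (auto simp: incseq_def le_fun_def)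
    then show ?case using seq by simp
  qed
  from this[OF g] show ?thesis by simp
qed

text \<open>A quantifier over a random set is not a countable union of fixed events. It is recovered
  as the nonvanishing of the sum of an indicator over the points.\<close>

lemma pred_ex_configuration:
  assumes \<Phi>: "\<Phi> \<in> measurable N configurations"
    and P: "Measurable.pred (N \<Otimes>\<^sub>M borel) (\<lambda>(s, x). P s x)"
  shows "Measurable.pred N (\<lambda>s. \<exists>x\<in>\<Phi> s. P s x)"
proof -
  have "(\<lambda>s. \<integral>\<^sup>+x. indicator {p \<in> space (N \<Otimes>\<^sub>M borel). case p of (s, x) \<Rightarrow> P s x} (s, x) \<partial>count_space (\<Phi> s))
      \<in> borel_measurable N"
    using P by (intro nn_integral_count_space_measurable[OF \<Phi>]) simp
  then have "Measurable.pred N (\<lambda>s. (\<integral>\<^sup>+x. indicator {p \<in> space (N \<Otimes>\<^sub>M borel). case p of (s, x) \<Rightarrow> P s x} (s, x)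
      \<partial>count_space (\<Phi> s)) \<noteq> (0::ennreal))"
    by measurable
  moreover have "(\<integral>\<^sup>+x. indicator {p \<in> space (N \<Otimes>\<^sub>M borel). case p of (s, x) \<Rightarrow> P s x} (s, x)
      \<partial>count_space (\<Phi> s)) \<noteq> (0::ennreal) \<longleftrightarrow> (\<exists>x\<in>\<Phi> s. P s x)" if "s \<in> space N" for s
    using that by (subst nn_integral_0_iff_AE)
      (auto simp: AE_count_space space_pair_measure indicator_def)
  ultimately show ?thesis
    by (subst measurable_cong[where g="\<lambda>s. (\<integral>\<^sup>+x. indicator {p \<in> space (N \<Otimes>\<^sub>M borel).
      case p of (s, x) \<Rightarrow> P s x} (s, x) \<partial>count_space (\<Phi> s)) \<noteq> (0::ennreal)"]) auto
qed

lemma pred_all_configuration: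
  assumes \<Phi>: "\<Phi> \<in> measurable N configurations"
    and P: "Measurable.pred (N \<Otimes>\<^sub>M borel) (\<lambda>(s, x). P s x)"
  shows "Measurable.pred N (\<lambda>s. \<forall>x\<in>\<Phi> s. P s x)"
proof -
  have "Measurable.pred (N \<Otimes>\<^sub>M borel) (\<lambda>(s, x). \<not> P s x)"
    using P by (simp add: split_beta)
  from pred_ex_configuration[OF \<Phi> this] have "Measurable.pred N (\<lambda>s. \<not> (\<exists>x\<in>\<Phi> s. \<not> P s x))"
    by (rule pred_intros_logic)
  then show ?thesis by simp
qed

text \<open>Avoiding \<open>B\<close> after the removal means that every point in \<open>B\<close>
  equals \<open>f s\<close>, a quantified condition of the kind just treated. The reduced
  configurations in \<open>palm_sum\<close> need this.\<close>

lemma measurable_remove_point: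
  assumes \<Phi>: "\<Phi> \<in> measurable N configurations" and f [measurable]: "f \<in> borel_measurable N"
  shows "(\<lambda>s. \<Phi> s - {f s}) \<in> measurable N configurations"
proof (rule measurable_configurationsI)
  fix s assume "s \<in> space N"
  then have "\<Phi> s \<in> locally_finite_sets"
    using measurable_space[OF \<Phi>] by (simp add: space_configurations)
  then show "\<Phi> s - {f s} \<in> locally_finite_sets"
    by (rule locally_finite_subset) auto
next
  fix B :: "plane set" assume [measurable]: "B \<in> sets borel" and "bounded B"
  have "Measurable.pred N (\<lambda>s. \<forall>x\<in>\<Phi> s. x \<in> B \<longrightarrow> x = f s)"
    by (intro pred_all_configuration[OF \<Phi>]) measurable
  then have "{s \<in> space N. \<forall>x\<in>\<Phi> s. x \<in> B \<longrightarrow> x = f s} \<in> sets N" by measurable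
  also have "{s \<in> space N. \<forall>x\<in>\<Phi> s. x \<in> B \<longrightarrow> x = f s} = {s \<in> space N. (\<Phi> s - {f s}) \<inter> B = {}}"
    by auto
  finally show "{s \<in> space N. (\<Phi> s - {f s}) \<inter> B = {}} \<in> sets N" .
qed

section \<open>Translations of configurations\<close>

lemma shift_void: "shift t \<phi> \<inter> B = {} \<longleftrightarrow> \<phi> \<inter> (\<lambda>x. x + t) -` B = {}"
  by (auto simp: shift_def)

lemma bounded_translation_vimage: "bounded ((\<lambda>x::plane. x + t) -` B) \<longleftrightarrow> bounded B"
proof -
  have "(\<lambda>x::plane. x + t) -` B = (\<lambda>x. x - t) ` B"
    by (auto simp: image_iff) (metis add_diff_cancel)
  moreover have "B = (\<lambda>x. x + t) ` (\<lambda>x. x - t) ` B"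
    by (simp add: image_image)
  ultimately show ?thesis
    using bounded_translation_minus[of B t] bounded_translation_minus[of "(\<lambda>x. x - t) ` B" "- t"]
    by auto
qed

lemma shift_locally_finite: "\<phi> \<in> locally_finite_sets \<Longrightarrow> shift t \<phi> \<in> locally_finite_sets"
  unfolding locally_finite_sets_def
proof clarify
  fix B :: "plane set" assume \<phi>: "\<forall>B. bounded B \<longrightarrow> finite (\<phi> \<inter> B)" and B: "bounded B"
  have "shift t \<phi> \<inter> B = (\<lambda>x. x + t) ` (\<phi> \<inter> (\<lambda>x. x + t) -` B)"
    by (auto simp: shift_def)
  then show "finite (shift t \<phi> \<inter> B)"
    using \<phi> B bounded_translation_vimage by simp
qed

lemma shift_shift: "shift s (shift t \<phi>) = shift (s + t) \<phi>"
  by (auto simp: shift_def image_image algebra_simps)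

lemma shift_0 [simp]: "shift 0 \<phi> = \<phi>"
  by (simp add: shift_def)

lemma measurable_shift [measurable]: "shift t \<in> measurable configurations configurations"
proof (rule measurable_configurationsI)
  fix B :: "plane set" assume B [measurable]: "B \<in> sets borel" and "bounded B"
  have "(\<lambda>x. x + t) -` B \<in> sets borel"
    using measurable_sets[of "\<lambda>x. x + t" borel borel B] by simp
  moreover have "bounded ((\<lambda>x. x + t) -` B)" using \<open>bounded B\<close> bounded_translation_vimage by blast
  ultimately have "void_event ((\<lambda>x. x + t) -` B) \<in> sets configurations" by (rule void_event_sets)
  then show "{\<phi> \<in> space configurations. shift t \<phi> \<inter> B = {}} \<in> sets configurations"
    by (simp add: shift_void void_event_def space_configurations)
qed (simp add: space_configurations shift_locally_finite)

section \<open>Stationarity and ergodicity of the Poisson law\<close>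

lemma configurations_measure_eqI:
  assumes "finite_measure M" "sets M = sets configurations" "sets N = sets configurations"
    and "\<And>B. B \<in> sets borel \<Longrightarrow> bounded B \<Longrightarrow> emeasure M (void_event B) = emeasure N (void_event B)"
  shows "M = N"
\<comment> \<open>\<open>void_event {}\<close> is the whole space, so a constant sequence serves as
  the exhausting one.\<close>
proof (rule measure_eqI_generator_eq[OF Int_stable_void_events, where \<Omega>=locally_finite_sets and A="\<lambda>_. void_event {}"])
  interpret finite_measure M by fact
  show "emeasure M (void_event {}) \<noteq> \<infinity>" for i :: nat by simp
qed (use assms in \<open>auto simp: sets_configurations_void void_event_def[of "{}"]\<close>, auto simp: void_event_def)

text \<open>The information visible through the window \<open>K\<close>, which may itself be
  unbounded. Disjoint windows carry independent information under a Poisson law.\<close>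

definition window_events :: "plane set \<Rightarrow> plane set set set" where
  "window_events K = sigma_sets locally_finite_sets {void_event B | B. B \<in> sets borel \<and> bounded B \<and> B \<subseteq> K}"

lemma window_events_subset: "window_events K \<subseteq> sets configurations"
  unfolding window_events_def sets_configurations_void by (rule sigma_sets_mono') auto

lemma window_events_mono: "K \<subseteq> L \<Longrightarrow> window_events K \<subseteq> window_events L"
  unfolding window_events_def by (rule sigma_sets_mono') auto

lemma sigma_algebra_window_events: "sigma_algebra locally_finite_sets (window_events K)"
  unfolding window_events_def by (rule sigma_algebra_sigma_sets) (auto simp: void_event_def)

text \<open>Moving the configuration by \<open>t\<close> is the same as moving the window by
  \<open>- t\<close>. This is clear for void events, and preimages commute with complements and
  countable unions.\<close>

lemma window_events_shift:
  assumes "F \<in> window_events K"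
  shows "{\<phi> \<in> locally_finite_sets. shift t \<phi> \<in> F} \<in> window_events ((\<lambda>x. x + t) -` K)"
proof -
  interpret W: sigma_algebra locally_finite_sets "window_events ((\<lambda>x. x + t) -` K)"
    by (rule sigma_algebra_window_events)
  show ?thesis
    using assms unfolding window_events_def[of K]
  proof (induction rule: sigma_sets.induct)
    case (Basic a)
    then obtain B where B: "a = void_event B" "B \<in> sets borel" "bounded B" "B \<subseteq> K" by auto
    have "{\<phi> \<in> locally_finite_sets. shift t \<phi> \<in> a} = void_event ((\<lambda>x. x + t) -` B)"
      by (auto simp: B(1) void_event_def shift_void shift_locally_finite)
    moreover have "(\<lambda>x. x + t) -` B \<in> sets borel"
      using measurable_sets[of "\<lambda>x. x + t" borel borel B] B(2) by simp
    ultimately show ?case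
      using B bounded_translation_vimage unfolding window_events_def
      by (intro sigma_sets.Basic) blast
  next
    case Empty
    then show ?case by simp
  next
    case (Compl a)
    have "{\<phi> \<in> locally_finite_sets. shift t \<phi> \<in> locally_finite_sets - a} =
        locally_finite_sets - {\<phi> \<in> locally_finite_sets. shift t \<phi> \<in> a}"
      by (auto simp: shift_locally_finite)
    then show ?case using W.compl_sets[OF Compl(2)] by simp
  next
    case (Union a)
    have "{\<phi> \<in> locally_finite_sets. shift t \<phi> \<in> (\<Union>i. a i)} =
        (\<Union>i. {\<phi> \<in> locally_finite_sets. shift t \<phi> \<in> a i})" by auto
    then show ?case using Union by auto
  qed
qed

lemma measure_lborel_translation_vimage:
  assumes [measurable]: "B \<in> sets borel"
  shows "measure lborel ((\<lambda>x::plane. x + t) -` B) = measure lborel B"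
proof -
  have "emeasure lborel B = emeasure (distr lborel borel ((+) t)) B"
    by (simp add: lborel_distr_plus)
  also have "\<dots> = emeasure lborel ((\<lambda>x. x + t) -` B)"
    by (subst emeasure_distr) (auto intro!: arg_cong[where f="emeasure lborel"] simp: add.commute)
  finally show ?thesis by (simp add: measure_def)
qed

text \<open>The factor \<open>n\<close> cancels against the factorial and shifts the exponential
  series by one. This is the mean of the Poisson weights before normalization.\<close>

lemma sums_nat_power_div_fact: "(\<lambda>n. real n * (a ^ n / fact n)) sums (a * exp a)"
proof -
  have "(\<lambda>n. a * (a ^ n / fact n)) sums (a * exp a)"
    using exp_converges[of a] by (intro sums_mult) (simp add: divide_inverse mult.commute)
  also have "(\<lambda>n. a * (a ^ n / fact n)) = (\<lambda>n. real (Suc n) * (a ^ Suc n / fact (Suc n)))"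
    by (rule ext) (simp add: field_simps del: of_nat_Suc)
  finally show ?thesis
    using sums_Suc[of "\<lambda>n. real n * (a ^ n / fact n)" "a * exp a"] by simp
qed

text \<open>A law on configurations, specified only by a count on one set jointly with a void on a
  disjoint one. Since void events generate, stationarity, independence and the Mecke formula can all
  be drawn from it.\<close>

locale poisson_law = prob_space P for P :: "plane set measure" +
  fixes l :: real
  assumes l_pos: "0 < l" and sets_P [measurable_cong, simp]: "sets P = sets configurations"
    and count_void: "A \<in> sets borel \<Longrightarrow> bounded A \<Longrightarrow> B \<in> sets borel \<Longrightarrow> bounded B \<Longrightarrow> A \<inter> B = {} \<Longrightarrow>
      prob {\<phi> \<in> locally_finite_sets. card (\<phi> \<inter> A) = n \<and> \<phi> \<inter> B = {}} =
        (l * measure lborel A) ^ n / fact n * exp (- (l * measure lborel A)) * exp (- (l * measure lborel B))"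
begin

lemma space_P [simp]: "space P = locally_finite_sets"
  using sets_eq_imp_space_eq[OF sets_P] by (simp add: space_configurations)

lemma id_measurable_P: "(\<lambda>\<phi>. \<phi>) \<in> measurable P configurations"
  by (simp add: measurable_ident_sets)

lemma prob_void: "B \<in> sets borel \<Longrightarrow> bounded B \<Longrightarrow> prob (void_event B) = exp (- (l * measure lborel B))"
  using count_void[of "{}" B 0] by (simp add: void_event_def)

lemma distr_shift: "distr P configurations (shift t) = P"
proof (rule configurations_measure_eqI)
  have m: "shift t \<in> measurable P configurations" by simp
  show "finite_measure (distr P configurations (shift t))"
    using prob_space.finite_measure[OF prob_space_distr[OF m]] prob_space.axioms(1) by simp
  fix B :: "plane set" assume B: "B \<in> sets borel" "bounded B"
  have *: "shift t -` void_event B \<inter> locally_finite_sets = void_event ((\<lambda>x. x + t) -` B)"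
    by (auto simp: void_event_def shift_void shift_locally_finite)
  have "(\<lambda>x. x + t) -` B \<in> sets borel"
    using measurable_sets[of "\<lambda>x. x + t" borel borel B] B(1) by simp
  then have "prob (void_event ((\<lambda>x. x + t) -` B)) = prob (void_event B)"
    using B by (simp add: prob_void bounded_translation_vimage measure_lborel_translation_vimage)
  then show "emeasure (distr P configurations (shift t)) (void_event B) = emeasure P (void_event B)"
    using B by (simp add: emeasure_distr void_event_sets * emeasure_eq_measure)
qed auto

lemma prob_shift:
  assumes "E \<in> sets configurations"
  shows "prob {\<phi> \<in> locally_finite_sets. shift t \<phi> \<in> E} = prob E"
proof -
  have "prob E = measure (distr P configurations (shift t)) E" by (simp add: distr_shift)
  also have "\<dots> = prob {\<phi> \<in> locally_finite_sets. shift t \<phi> \<in> E}"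
    using assms by (subst measure_distr) (auto intro!: arg_cong[where f=prob])
  finally show ?thesis by simp
qed

text \<open>Void probabilities are exponential in the area, and area is additive over disjoint sets,
  so void events in the two windows factorize. Both families are intersection-stable, hence
  independence passes to the generated sigma-algebras.\<close>

lemma prob_window_Int:
  assumes "K \<inter> L = {}" "F \<in> window_events K" "G \<in> window_events L"
  shows "prob (F \<inter> G) = prob F * prob G"
proof -
  let ?V = "\<lambda>K. {void_event B | B. B \<in> sets borel \<and> bounded B \<and> B \<subseteq> K}"
  have stable: "Int_stable (?V K)" for K
  proof (rule Int_stableI, clarify)
    fix B C :: "plane set"
    assume "B \<in> sets borel" "bounded B" "B \<subseteq> K" "C \<in> sets borel" "bounded C" "C \<subseteq> K"
    moreover have "void_event B \<inter> void_event C = void_event (B \<union> C)"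
      by (auto simp: void_event_def)
    ultimately show "\<exists>D. void_event B \<inter> void_event C = void_event D \<and> D \<in> sets borel \<and> bounded D \<and> D \<subseteq> K"
      by (auto intro!: exI[of _ "B \<union> C"])
  qed
  have "indep_set (?V K) (?V L)"
    unfolding indep_sets2_eq
  proof (intro conjI ballI)
    fix a b assume "a \<in> ?V K" "b \<in> ?V L"
    then obtain B C where BC: "a = void_event B" "B \<in> sets borel" "bounded B" "B \<subseteq> K"
       "b = void_event C" "C \<in> sets borel" "bounded C" "C \<subseteq> L" by auto
    then have d: "B \<inter> C = {}" using assms(1) by auto
    have "void_event B \<inter> void_event C = void_event (B \<union> C)" by (auto simp: void_event_def)
    moreover have "measure lborel (B \<union> C) = measure lborel B + measure lborel C"
    proof (rule measure_Un2[THEN trans])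
      show "B \<in> fmeasurable lborel" "C \<in> fmeasurable lborel"
        using BC emeasure_bounded_finite[of B] emeasure_bounded_finite[of C] by (auto simp: fmeasurable_def)
      show "measure lborel B + measure lborel (C - B) = measure lborel B + measure lborel C"
        using d by (simp add: Diff_triv Int_commute)
    qed
    ultimately show "prob (a \<inter> b) = prob a * prob b"
      using BC by (simp add: prob_void exp_add[symmetric] algebra_simps)
  qed (auto intro: void_event_sets)
  then have "indep_set (window_events K) (window_events L)"
    using indep_set_sigma_sets[OF _ stable stable] unfolding window_events_def by simp
  then show ?thesis using assms by (auto simp: indep_sets2_eq)
qed

text \<open>Void events already depend on a bounded window. Complements preserve the approximation
  exactly; a countable union is cut off at a finite stage, whose windows lie in a common
  ball.\<close>

lemma window_approximation:
  assumes "E \<in> sets configurations" "\<epsilon> > 0"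
  shows "\<exists>n. \<exists>F\<in>window_events (ball 0 (real n)). prob (sym_diff E F) < \<epsilon>"
proof -
  have sub: "{void_event B |B. B \<in> sets borel \<and> bounded B} \<subseteq> Pow locally_finite_sets"
    by (auto simp: void_event_def)
  show ?thesis
    using Int_stable_void_events sub assms(1)[unfolded sets_configurations_void] assms(2)
  proof (induction arbitrary: \<epsilon> rule: sigma_sets_induct_disjoint)
    case (basic A)
    then obtain B where B: "A = void_event B" "B \<in> sets borel" "bounded B" by auto
    obtain n :: nat where "B \<subseteq> ball 0 (real n)"
      using bounded_subset_ballD[OF B(3), of 0] reals_Archimedean2
      by (metis order.strict_implies_order subset_ball subset_trans)
    then have "A \<in> window_events (ball 0 (real n))"
      unfolding window_events_def using B by (intro sigma_sets.Basic) auto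
    then show ?case using basic(2) by (intro exI bexI[of _ A]) auto
  next
    case empty
    have "{} \<in> window_events (ball 0 (real 0))"
      unfolding window_events_def by (rule sigma_sets.Empty)
    then show ?case using empty by (intro exI[of _ 0] bexI[of _ "{}"]) auto
  next
    case (compl A)
    then obtain n F where F: "F \<in> window_events (ball 0 (real n))" "prob (sym_diff A F) < \<epsilon>" by blast
    interpret W: sigma_algebra locally_finite_sets "window_events (ball 0 (real n))"
      by (rule sigma_algebra_window_events)
    have sub: "A \<subseteq> locally_finite_sets" "F \<subseteq> locally_finite_sets"
      using compl(1) F(1) sets.sets_into_space[of _ configurations] W.sets_into_space
      unfolding sets_configurations_void[symmetric] space_configurations by auto
    have "sym_diff (locally_finite_sets - A) (locally_finite_sets - F) = sym_diff A F"
      using sub by auto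
    then show ?case using F by (intro exI bexI[of _ "locally_finite_sets - F"]) auto
  next
    case (union A)
    have A [measurable]: "A i \<in> sets configurations" for i
      using union(2) unfolding sets_configurations_void[symmetric] by auto
    have "(\<lambda>n. prob (\<Union>i<n. A i)) \<longlonglongrightarrow> prob (\<Union>n. \<Union>i<n. A i)"
      by (intro finite_Lim_measure_incseq) (auto simp: incseq_def intro: order.strict_trans2)
    also have "(\<Union>n. \<Union>i<n. A i) = (\<Union>i. A i)" by blast
    finally have "\<forall>\<^sub>F n in sequentially. dist (prob (\<Union>i<n. A i)) (prob (\<Union>i. A i)) < \<epsilon> / 2"
      using union(4) by (intro tendstoD) auto
    then obtain N where N: "dist (prob (\<Union>i<N. A i)) (prob (\<Union>i. A i)) < \<epsilon> / 2"
      unfolding eventually_sequentially by blast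
    \<comment> \<open>The tail costs less than \<epsilon>/2, and \<open>N\<close> errors \<delta>
      also sum to less than \<epsilon>/2. The summand 1 covers \<open>N = 0\<close>, as does the 0
      in the maximum \<open>m\<close> below.\<close>
    define \<delta> where "\<delta> = \<epsilon> / (2 * (real N + 1))"
    have "\<delta> > 0" using union(4) by (simp add: \<delta>_def)
    then have "\<forall>i. \<exists>n. \<exists>F\<in>window_events (ball 0 (real n)). prob (sym_diff (A i) F) < \<delta>"
      using union(3) by blast
    then obtain n F where F: "\<And>i. F i \<in> window_events (ball 0 (real (n i)))"
        "\<And>i. prob (sym_diff (A i) (F i)) < \<delta>" by metis
    have [measurable]: "F i \<in> sets configurations" for i
      using F(1) window_events_subset by blast
    define m where "m = Max (n ` {..<N} \<union> {0})"
    interpret W: sigma_algebra locally_finite_sets "window_events (ball 0 (real m))"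
      by (rule sigma_algebra_window_events)
    have "F i \<in> window_events (ball 0 (real m))" if "i < N" for i
    proof -
      have "n i \<le> m" unfolding m_def using that by (intro Max_ge) auto
      then have "ball 0 (real (n i)) \<subseteq> (ball 0 (real m) :: plane set)" by (intro subset_ball) simp
      then show ?thesis using F(1)[of i] window_events_mono by blast
    qed
    then have W: "(\<Union>i<N. F i) \<in> window_events (ball 0 (real m))" by auto
    have "prob (sym_diff (\<Union>i. A i) (\<Union>i<N. F i)) \<le>
        prob (((\<Union>i. A i) - (\<Union>i<N. A i)) \<union> (\<Union>i<N. sym_diff (A i) (F i)))"
      by (intro finite_measure_mono) auto
    also have "\<dots> \<le> prob ((\<Union>i. A i) - (\<Union>i<N. A i)) + prob (\<Union>i<N. sym_diff (A i) (F i))"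
      by (intro measure_Un_le) auto
    also have "prob (\<Union>i<N. sym_diff (A i) (F i)) \<le> (\<Sum>i<N. prob (sym_diff (A i) (F i)))"
      by (intro finite_measure_subadditive_finite) auto
    also have "\<dots> \<le> (\<Sum>i<N. \<delta>)" using F(2) by (intro sum_mono less_imp_le)
    also have "\<dots> < \<epsilon> / 2"
      using union(4) by (simp add: \<delta>_def field_simps)
    also have "prob ((\<Union>i. A i) - (\<Union>i<N. A i)) = prob (\<Union>i. A i) - prob (\<Union>i<N. A i)"
      by (intro finite_measure_Diff) auto
    also have "\<dots> < \<epsilon> / 2" using N unfolding dist_real_def by linarith
    finally have "prob (sym_diff (\<Union>i. A i) (\<Union>i<N. F i)) < \<epsilon>" by simp
    then show ?case using W by blast
  qed
qed

text \<open>Approximating an invariant event \<open>E\<close> by a window event \<open>F\<close>, a far translate of \<open>F\<close> is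
  independent of \<open>F\<close> and still approximates \<open>E\<close>, whence \<open>prob E = prob E ^ 2\<close>.\<close>

theorem shift_invariant_trivial:
  assumes E [measurable]: "E \<in> sets configurations" and inv: "\<And>t. shift t ` E = E"
  shows "prob E \<in> {0, 1}"
proof -
  have E_iff: "shift t \<phi> \<in> E \<longleftrightarrow> \<phi> \<in> E" for t \<phi>
  proof
    assume "shift t \<phi> \<in> E"
    then have "shift (- t) (shift t \<phi>) \<in> shift (- t) ` E" by blast
    then show "\<phi> \<in> E" by (simp add: shift_shift inv)
  next
    assume "\<phi> \<in> E"
    then have "shift t \<phi> \<in> shift t ` E" by blast
    then show "shift t \<phi> \<in> E" by (simp add: inv)
  qed
  \<comment> \<open>Two errors of at most 2\<epsilon> each: one from replacing \<open>E\<close> by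
    the intersection of \<open>F\<close> with its translate, one from replacing the square of
    \<open>prob E\<close> by that of \<open>prob F\<close>.\<close>
  have "\<bar>prob E - prob E * prob E\<bar> \<le> 4 * \<epsilon>" if pos: "\<epsilon> > 0" for \<epsilon>
  proof -
    obtain n F where F: "F \<in> window_events (ball 0 (real n))" "prob (sym_diff E F) < \<epsilon>"
      using window_approximation[OF E pos] by auto
    have [measurable]: "F \<in> sets configurations" using F(1) window_events_subset by blast
    \<comment> \<open>One coordinate already gives \<open>t\<close> length at least
      \<open>2 * n\<close>, which separates an open ball of radius \<open>n\<close> from its
      translate.\<close>
    define t :: plane where "t = vec (2 * real n)"
    define G where "G = {\<phi> \<in> locally_finite_sets. shift t \<phi> \<in> F}"
    have t: "norm t \<ge> 2 * real n"
      using component_le_norm_cart[of t 1] by (simp add: t_def)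
    have G: "G \<in> window_events ((\<lambda>x. x + t) -` ball 0 (real n))"
      unfolding G_def by (rule window_events_shift[OF F(1)])
    then have [measurable]: "G \<in> sets configurations" using window_events_subset by blast
    have "norm t < 2 * real n" if "norm x < real n" "norm (x + t) < real n" for x
      using that norm_triangle_ineq4[of "x + t" x] by simp
    then have "ball 0 (real n) \<inter> (\<lambda>x. x + t) -` ball 0 (real n) = {}"
      using t by (force simp: dist_norm)
    then have FG: "prob (F \<inter> G) = prob F * prob G" using F(1) G by (rule prob_window_Int)
    have pG: "prob G = prob F" unfolding G_def by (rule prob_shift) simp
    have E_sub: "E \<subseteq> locally_finite_sets"
      using sets.sets_into_space[OF E] by (simp add: space_configurations)
    have "sym_diff E G = {\<phi> \<in> locally_finite_sets. shift t \<phi> \<in> sym_diff E F}"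
      using E_sub by (auto simp: G_def E_iff)
    then have EG: "prob (sym_diff E G) < \<epsilon>"
      using prob_shift[of "sym_diff E F" t] F(2) by simp
    have *: "\<bar>prob X - prob Y\<bar> \<le> prob (sym_diff X Y)"
      if [measurable]: "X \<in> sets configurations" "Y \<in> sets configurations" for X Y
    proof -
      have "prob X \<le> prob (Y \<union> sym_diff X Y)" "prob Y \<le> prob (X \<union> sym_diff X Y)"
        by (auto intro!: finite_measure_mono)
      moreover have "prob (Y \<union> sym_diff X Y) \<le> prob Y + prob (sym_diff X Y)"
        "prob (X \<union> sym_diff X Y) \<le> prob X + prob (sym_diff X Y)"
        by (auto intro!: measure_Un_le)
      ultimately show ?thesis by linarith
    qed
    have 1: "\<bar>prob E - prob F\<bar> < \<epsilon>" using *[of E F] F(2) by simp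
    have 2: "\<bar>prob E - prob F * prob F\<bar> < 2 * \<epsilon>"
    proof -
      have "prob (sym_diff E (F \<inter> G)) \<le> prob (sym_diff E F \<union> sym_diff E G)"
        by (intro finite_measure_mono) auto
      also have "\<dots> \<le> prob (sym_diff E F) + prob (sym_diff E G)"
        by (intro measure_Un_le) auto
      finally show ?thesis using *[of E "F \<inter> G"] F(2) EG by (simp add: FG pG)
    qed
    have 3: "\<bar>prob E * prob E - prob F * prob F\<bar> \<le> 2 * \<bar>prob E - prob F\<bar>"
    proof -
      have "\<bar>prob E * prob E - prob F * prob F\<bar> = \<bar>prob E + prob F\<bar> * \<bar>prob E - prob F\<bar>"
        unfolding abs_mult[symmetric] by (simp only: algebra_simps)
      also have "\<dots> \<le> 2 * \<bar>prob E - prob F\<bar>"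
        using prob_le_1[of E] prob_le_1[of F] measure_nonneg[of P E] measure_nonneg[of P F]
        by (intro mult_right_mono, linarith) simp
      finally show ?thesis .
    qed
    from 1 2 3 show ?thesis by argo
  qed
  \<comment> \<open>For a nonzero difference \<open>d\<close> this choice would give
    \<open>|d| \<le> |d| / 2\<close>.\<close>
  from this[of "\<bar>prob E - prob E * prob E\<bar> / 8"] have "prob E - prob E * prob E = 0"
    by (cases "prob E - prob E * prob E = 0") auto
  then have "prob E * (1 - prob E) = 0" by (simp add: algebra_simps)
  then show ?thesis by auto
qed

end

section \<open>The Mecke formula\<close>

lemma content_Diff_Int:
  fixes U V :: "plane set"
  assumes "U \<in> sets borel" "bounded U" "V \<in> sets borel"
  shows "measure lborel U = measure lborel (U - V) + measure lborel (U \<inter> V)"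
proof -
  have "emeasure lborel (U - V) < \<infinity>" "emeasure lborel (U \<inter> V) < \<infinity>"
    using assms(2) by (intro emeasure_bounded_finite; blast intro: bounded_subset)+
  then have "measure lborel ((U - V) \<union> (U \<inter> V)) = measure lborel (U - V) + measure lborel (U \<inter> V)"
    using assms by (intro measure_Union) auto
  moreover have "(U - V) \<union> (U \<inter> V) = U" by auto
  ultimately show ?thesis by simp
qed

context poisson_law
begin

text \<open>Splitting by the value of the count leaves the Poisson first-moment series; its factor
  \<open>exp a\<close> cancels the normalization.\<close>

lemma nn_integral_count_void:
  assumes [measurable]: "A \<in> sets borel" "B \<in> sets borel" and "bounded A" "bounded B" "A \<inter> B = {}"
  shows "(\<integral>\<^sup>+\<phi>. of_nat (card (\<phi> \<inter> A)) * indicator (void_event B) \<phi> \<partial>P) =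
    ennreal (l * measure lborel A * exp (- (l * measure lborel B)))"
proof -
  let ?a = "l * measure lborel A" and ?b = "l * measure lborel B"
  define C where "C n = {\<phi> \<in> locally_finite_sets. card (\<phi> \<inter> A) = n \<and> \<phi> \<inter> B = {}}" for n
  have card [measurable]: "(\<lambda>\<phi>. card (\<phi> \<inter> A)) \<in> measurable P (count_space UNIV)"
    using assms by (intro measurable_card_Int id_measurable_P)
  have C_eq: "C n = {\<phi> \<in> space P. card (\<phi> \<inter> A) = n} \<inter> void_event B" for n
    by (auto simp: C_def void_event_def)
  have C [measurable]: "C n \<in> sets configurations" for n
  proof -
    have "{\<phi> \<in> space P. card (\<phi> \<inter> A) = n} \<in> sets P" by measurable
    then show ?thesis unfolding C_eq using void_event_sets[of B] assms by auto
  qed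
  have "(\<Sum>n. of_nat n * indicator (C n) \<phi>) = (of_nat (card (\<phi> \<inter> A)) * indicator (void_event B) \<phi> :: ennreal)"
    if "\<phi> \<in> space P" for \<phi>
  proof -
    have "(\<Sum>n. of_nat n * indicator (C n) \<phi> :: ennreal) = (\<Sum>n\<in>{card (\<phi> \<inter> A)}. of_nat n * indicator (C n) \<phi>)"
      by (intro suminf_finite) (auto simp: C_def)
    then show ?thesis using that by (simp add: C_eq indicator_def)
  qed
  then have "(\<integral>\<^sup>+\<phi>. of_nat (card (\<phi> \<inter> A)) * indicator (void_event B) \<phi> \<partial>P) =
      (\<integral>\<^sup>+\<phi>. (\<Sum>n. of_nat n * indicator (C n) \<phi>) \<partial>P)"
    by (intro nn_integral_cong) simp
  also have "\<dots> = (\<Sum>n. \<integral>\<^sup>+\<phi>. of_nat n * indicator (C n) \<phi> \<partial>P)"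
    by (intro nn_integral_suminf) simp
  also have "\<dots> = (\<Sum>n. of_nat n * emeasure P (C n))"
    by (simp add: nn_integral_cmult)
  also have "\<dots> = (\<Sum>n. ennreal (real n * (?a ^ n / fact n) * exp (- ?a) * exp (- ?b)))"
    unfolding emeasure_eq_measure C_def count_void[OF assms(1) assms(3) assms(2) assms(4) assms(5)]
    by (simp add: ennreal_of_nat_eq_real_of_nat ennreal_mult'[symmetric] mult_ac)
  also have "\<dots> = ennreal (?a * exp ?a * exp (- ?a) * exp (- ?b))"
    using l_pos by (intro suminf_ennreal_eq sums_mult2 sums_nat_power_div_fact) auto
  also have "?a * exp ?a * exp (- ?a) * exp (- ?b) = ?a * exp (- ?b)"
    by (simp add: mult.assoc exp_add[symmetric])
  finally show ?thesis .
qed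

text \<open>The functional averaged in the reduced Mecke formula: since the point is deleted here,
  none has to be added on the other side.\<close>

definition palm_sum :: "(plane \<times> plane set \<Rightarrow> ennreal) \<Rightarrow> plane set \<Rightarrow> ennreal" where
  "palm_sum f \<phi> = (\<integral>\<^sup>+x. f (x, \<phi> - {x}) \<partial>count_space \<phi>)"

text \<open>The parameter \<open>s\<close> and the varying configuration serve the iterated sum over
  pairs, whose inner sum depends on the first point and runs over what remains after its
  removal.\<close>

lemma measurable_palm_sum:
  assumes f: "f \<in> borel_measurable (N \<Otimes>\<^sub>M (borel \<Otimes>\<^sub>M P))" and \<Phi>: "\<Phi> \<in> measurable N configurations"
  shows "(\<lambda>s. palm_sum (\<lambda>p. f (s, p)) (\<Phi> s)) \<in> borel_measurable N"
  unfolding palm_sum_def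
proof (rule nn_integral_count_space_measurable[OF \<Phi>])
  have "(\<lambda>p. \<Phi> (fst p) - {snd p}) \<in> measurable (N \<Otimes>\<^sub>M borel) configurations"
    by (rule measurable_remove_point) (auto intro: measurable_compose[OF _ \<Phi>])
  then have "(\<lambda>p. (fst p, snd p, \<Phi> (fst p) - {snd p})) \<in> measurable (N \<Otimes>\<^sub>M borel) (N \<Otimes>\<^sub>M (borel \<Otimes>\<^sub>M P))"
    by (intro measurable_Pair) auto
  from measurable_compose[OF this f]
  show "(\<lambda>(s, x). f (s, x, \<Phi> s - {x})) \<in> borel_measurable (N \<Otimes>\<^sub>M borel)" by (simp add: split_beta')
qed

lemma measurable_palm_sum_P [measurable]:
  assumes f: "f \<in> borel_measurable (borel \<Otimes>\<^sub>M P)"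
  shows "palm_sum f \<in> borel_measurable P"
  using measurable_palm_sum[of "\<lambda>(s, p). f p" P "\<lambda>\<phi>. \<phi>"] id_measurable_P f by simp

text \<open>The points of \<open>\<phi>\<close> in \<open>A - B\<close> all contribute when \<open>\<phi>\<close> avoids \<open>B\<close>; a point in \<open>A \<inter> B\<close>
  contributes only if it is the only point of \<open>\<phi>\<close> in \<open>B\<close>.\<close>

lemma palm_sum_rectangle:
  assumes "\<phi> \<in> locally_finite_sets" "bounded A"
  shows "palm_sum (indicator (A \<times> void_event B)) \<phi> =
    of_nat (card (\<phi> \<inter> (A - B))) * indicator (void_event B) \<phi> +
    indicator {\<phi> \<in> locally_finite_sets. card (\<phi> \<inter> (A \<inter> B)) = 1 \<and> \<phi> \<inter> (B - A) = {}} \<phi>"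
proof -
  have fin: "finite (\<phi> \<inter> A)" using assms by (rule locally_finiteD)
  have lf: "\<phi> - {x} \<in> locally_finite_sets" for x using assms(1) by (rule locally_finite_subset) auto
  have "palm_sum (indicator (A \<times> void_event B)) \<phi> =
      (\<integral>\<^sup>+x. indicator {x \<in> \<phi> \<inter> A. (\<phi> - {x}) \<inter> B = {}} x \<partial>count_space UNIV)"
    unfolding palm_sum_def
    by (subst nn_integral_count_space_indicator, simp, rule nn_integral_cong)
       (auto simp: void_event_def lf split: split_indicator)
  also have "\<dots> = emeasure (count_space UNIV) {x \<in> \<phi> \<inter> A. (\<phi> - {x}) \<inter> B = {}}"
    by (rule nn_integral_indicator) simp
  also have "\<dots> = of_nat (card {x \<in> \<phi> \<inter> A. (\<phi> - {x}) \<inter> B = {}})"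
    by (intro emeasure_count_space_finite finite_subset[OF _ fin]) auto
  finally have *: "palm_sum (indicator (A \<times> void_event B)) \<phi> =
      of_nat (card {x \<in> \<phi> \<inter> A. (\<phi> - {x}) \<inter> B = {}})" .
  \<comment> \<open>Removing one point can empty \<open>B\<close> only if \<open>B\<close> holds at
    most one point. With two or more points in \<open>B\<close> both sides vanish.\<close>
  consider "\<phi> \<inter> B = {}" | x where "\<phi> \<inter> B = {x}" "x \<in> A" | x where "\<phi> \<inter> B = {x}" "x \<notin> A"
    | x y where "x \<in> \<phi> \<inter> B" "y \<in> \<phi> \<inter> B" "x \<noteq> y" by blast
  then show ?thesis
  proof cases
    case 1
    then have "{x \<in> \<phi> \<inter> A. (\<phi> - {x}) \<inter> B = {}} = \<phi> \<inter> (A - B)" "\<phi> \<inter> (A \<inter> B) = {}" by auto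
    then show ?thesis using 1 assms(1) unfolding * by (simp add: void_event_def)
  next
    case 2
    then have "{x \<in> \<phi> \<inter> A. (\<phi> - {x}) \<inter> B = {}} = {x}" "\<phi> \<inter> (A \<inter> B) = {x}" "\<phi> \<inter> (B - A) = {}" by auto
    then show ?thesis using 2 assms(1) unfolding * by (simp add: void_event_def)
  next
    case 3
    then have "{x \<in> \<phi> \<inter> A. (\<phi> - {x}) \<inter> B = {}} = {}" "\<phi> \<inter> (B - A) \<noteq> {}" by auto
    then show ?thesis using 3 assms(1) unfolding * by (simp only:) (simp add: void_event_def)
  next
    case 4
    then have e: "{x \<in> \<phi> \<inter> A. (\<phi> - {x}) \<inter> B = {}} = {}" by auto
    have "\<not> (card (\<phi> \<inter> (A \<inter> B)) = 1 \<and> \<phi> \<inter> (B - A) = {})"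
    proof
      assume h: "card (\<phi> \<inter> (A \<inter> B)) = 1 \<and> \<phi> \<inter> (B - A) = {}"
      have "\<phi> \<inter> B = \<phi> \<inter> (A \<inter> B)" using h by blast
      then have "card (\<phi> \<inter> B) = 1" using h by simp
      then obtain z where "\<phi> \<inter> B = {z}" by (meson card_1_singletonE)
      then have "x = z" "y = z" using 4(1,2) by simp_all
      then show False using 4(3) by simp
    qed
    moreover have "\<phi> \<notin> void_event B" using 4(1) by (auto simp: void_event_def)
    ultimately show ?thesis unfolding * e by simp
  qed
qed

text \<open>Points of \<open>A - B\<close> contribute when \<open>B\<close> is empty, a point of
  \<open>A \<inter> B\<close> when it is alone in \<open>B\<close>. Both parts carry the factor
  \<open>exp (- (l * area B))\<close>, and the two areas add up to that of \<open>A\<close>.\<close>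

lemma nn_integral_palm_sum_rectangle:
  assumes A: "A \<in> sets borel" "bounded A" and B: "B \<in> sets borel" "bounded B"
  shows "(\<integral>\<^sup>+\<phi>. palm_sum (indicator (A \<times> void_event B)) \<phi> \<partial>P) =
    ennreal l * (emeasure lborel A * emeasure P (void_event B))"
proof -
  define U where "U = {\<phi> \<in> locally_finite_sets. card (\<phi> \<inter> (A \<inter> B)) = 1 \<and> \<phi> \<inter> (B - A) = {}}"
  let ?m = "measure lborel"
  note AB = A(1)[measurable] B(1)[measurable]
  have fin: "X \<in> fmeasurable lborel" if "X \<in> sets borel" "bounded X" for X :: "plane set"
    using that emeasure_bounded_finite[of X] by (auto simp: fmeasurable_def)
  have mA: "?m A = ?m (A - B) + ?m (A \<inter> B)" and mB: "?m B = ?m (A \<inter> B) + ?m (B - A)"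
    using content_Diff_Int[OF A B(1)] content_Diff_Int[OF B A(1)] by (simp_all add: Int_commute)
  have U: "prob U = l * ?m (A \<inter> B) * exp (- (l * ?m B))"
    unfolding U_def using A B
    by (subst count_void) (auto intro: bounded_subset simp: mB exp_add[symmetric] algebra_simps)
  have UB: "U = {\<phi> \<in> space P. card (\<phi> \<inter> (A \<inter> B)) = 1} \<inter> void_event (B - A)"
    by (auto simp: U_def void_event_def)
  have card [measurable]: "(\<lambda>\<phi>. card (\<phi> \<inter> (A \<inter> B))) \<in> measurable P (count_space UNIV)"
    using A B by (intro measurable_card_Int id_measurable_P) (auto intro: bounded_subset)
  have card' [measurable]: "(\<lambda>\<phi>. card (\<phi> \<inter> (A - B))) \<in> measurable P (count_space UNIV)"
    using A B by (intro measurable_card_Int id_measurable_P) (auto intro: bounded_subset)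
  have [measurable]: "void_event B \<in> sets P" "void_event (B - A) \<in> sets P"
    using A B by (auto intro!: void_event_sets bounded_diff)
  have "U \<in> sets P" unfolding UB by measurable
  then have UP [measurable]: "U \<in> sets configurations" by simp
  have "(\<integral>\<^sup>+\<phi>. palm_sum (indicator (A \<times> void_event B)) \<phi> \<partial>P) =
      (\<integral>\<^sup>+\<phi>. of_nat (card (\<phi> \<inter> (A - B))) * indicator (void_event B) \<phi> + indicator U \<phi> \<partial>P)"
    unfolding U_def using A by (intro nn_integral_cong) (simp add: palm_sum_rectangle)
  also have "\<dots> = (\<integral>\<^sup>+\<phi>. of_nat (card (\<phi> \<inter> (A - B))) * indicator (void_event B) \<phi> \<partial>P) + emeasure P U"
    by (subst nn_integral_add) (auto simp del: nn_integral_indicator intro!: nn_integral_indicator UP)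
  also have "\<dots> = ennreal (l * ?m (A - B) * exp (- (l * ?m B))) + ennreal (l * ?m (A \<inter> B) * exp (- (l * ?m B)))"
    using A B by (subst nn_integral_count_void) (auto simp: emeasure_eq_measure U intro: bounded_diff)
  also have "\<dots> = ennreal (l * ?m A * exp (- (l * ?m B)))"
    using l_pos by (subst ennreal_plus[symmetric]) (auto simp: mA algebra_simps)
  also have "\<dots> = ennreal l * (emeasure lborel A * emeasure P (void_event B))"
    using l_pos fin[OF A] B
    by (simp add: emeasure_eq_measure prob_void emeasure_eq_measure2 ennreal_mult'[symmetric] mult.assoc)
  finally show ?thesis .
qed

text \<open>The Mecke formula. As functions of a set of pairs (point, configuration), both sides are
  measures that agree on the rectangles of the preceding lemma. Uniqueness of measures gives all
  measurable sets, and monotone approximation all nonnegative integrands.\<close>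

lemma nn_integral_palm_sum:
  assumes f: "f \<in> borel_measurable (borel \<Otimes>\<^sub>M P)"
  shows "(\<integral>\<^sup>+\<phi>. palm_sum f \<phi> \<partial>P) = ennreal l * (\<integral>\<^sup>+x. \<integral>\<^sup>+\<phi>. f (x, \<phi>) \<partial>P \<partial>lborel)"
proof -
  let ?\<Omega> = "UNIV \<times> locally_finite_sets :: (plane \<times> plane set) set"
  let ?S = "sets (borel \<Otimes>\<^sub>M P) :: (plane \<times> plane set) set set"
  let ?E = "{A \<times> V | A V. A \<in> {A :: plane set. A \<in> sets borel \<and> bounded A} \<and>
    V \<in> {void_event B | B. B \<in> sets borel \<and> bounded B}}"
  \<comment> \<open>The reduced Campbell measure of the process; \<nu> is the product measure it is
    to be identified with.\<close>
  define \<mu> where "\<mu> = measure_of ?\<Omega> ?S (\<lambda>S. \<integral>\<^sup>+\<phi>. palm_sum (indicator S) \<phi> \<partial>P)"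
  define \<nu> where "\<nu> = scale_measure (ennreal l) ((lborel :: plane measure) \<Otimes>\<^sub>M P)"
  have sp: "space (borel \<Otimes>\<^sub>M P) = ?\<Omega>" by (simp add: space_pair_measure)
  have sets_\<mu> [measurable_cong, simp]: "sets \<mu> = ?S"
    unfolding \<mu>_def sp[symmetric] by (simp only: sets.sets_measure_of_eq)
  have sets_\<nu> [measurable_cong, simp]: "sets \<nu> = ?S"
    unfolding \<nu>_def by (simp cong: sets_pair_measure_cong)
  have ind: "palm_sum (indicator S) \<in> borel_measurable P" if "S \<in> ?S" for S
    using that by measurable
  have \<mu>: "emeasure \<mu> S = (\<integral>\<^sup>+\<phi>. palm_sum (indicator S) \<phi> \<partial>P)" if "S \<in> ?S" for S
    unfolding \<mu>_def
  proof (rule emeasure_measure_of_sigma)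
    show "sigma_algebra ?\<Omega> ?S" unfolding sp[symmetric] by (rule sets.sigma_algebra_axioms)
    show "positive ?S (\<lambda>S. \<integral>\<^sup>+\<phi>. palm_sum (indicator S) \<phi> \<partial>P)"
      by (auto simp: positive_def palm_sum_def)
    show "countably_additive ?S (\<lambda>S. \<integral>\<^sup>+\<phi>. palm_sum (indicator S) \<phi> \<partial>P)"
    proof (rule countably_additiveI)
      fix S :: "nat \<Rightarrow> _" assume S: "range S \<subseteq> ?S" "disjoint_family S"
      have "(\<Sum>i. \<integral>\<^sup>+\<phi>. palm_sum (indicator (S i)) \<phi> \<partial>P) = (\<integral>\<^sup>+\<phi>. (\<Sum>i. palm_sum (indicator (S i)) \<phi>) \<partial>P)"
        using S(1) by (intro nn_integral_suminf[symmetric] ind) auto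
      also have "(\<lambda>\<phi>. \<Sum>i. palm_sum (indicator (S i)) \<phi>) = palm_sum (indicator (\<Union>i. S i))"
        unfolding palm_sum_def
        by (rule ext, subst nn_integral_suminf[symmetric])
           (auto intro!: nn_integral_cong simp: suminf_indicator[OF S(2)])
      finally show "(\<Sum>i. \<integral>\<^sup>+\<phi>. palm_sum (indicator (S i)) \<phi> \<partial>P) = (\<integral>\<^sup>+\<phi>. palm_sum (indicator (\<Union>i. S i)) \<phi> \<partial>P)" .
    qed
  qed (use that in auto)
  have S_gen: "?S = sigma_sets ?\<Omega> ?E"
  proof -
    have "sets (borel \<Otimes>\<^sub>M P) = sets (sigma (space (borel::plane measure) \<times> space P) ?E)"
    proof (rule sets_pair_eq[where Ca="range (\<lambda>n::nat. ball 0 (real n))" and Cb="{void_event {}}"])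
      \<comment> \<open>Boxes are bounded, so bounded Borel sets generate; restricting to them keeps
        the measures of the rectangles finite.\<close>
      show "sets (borel :: plane measure) = sigma_sets (space borel) {A. A \<in> sets borel \<and> bounded A}"
      proof
        have "sets (borel :: plane measure) = sigma_sets UNIV (range (\<lambda>(a, b). box a b))"
          by (subst borel_eq_box) simp
        also have "\<dots> \<subseteq> sigma_sets UNIV {A. A \<in> sets borel \<and> bounded A}"
          by (rule sigma_sets_mono') auto
        finally show "sets borel \<subseteq> sigma_sets (space (borel :: plane measure)) {A. A \<in> sets borel \<and> bounded A}"
          by simp
        show "sigma_sets (space (borel :: plane measure)) {A. A \<in> sets borel \<and> bounded A} \<subseteq> sets borel"
          by (rule sets.sigma_sets_subset) auto
      qed
      show "\<Union> (range (\<lambda>n::nat. ball 0 (real n))) = space (borel :: plane measure)"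
        using reals_Archimedean2 by auto
      show "sets P = sigma_sets (space P) {void_event B | B. B \<in> sets borel \<and> bounded B}"
        by (simp add: sets_configurations_void)
    qed (auto simp: void_event_def)
    also have "\<dots> = sigma_sets ?\<Omega> ?E"
      by (subst sets_measure_of) (auto simp: void_event_def)
    finally show ?thesis .
  qed
  have eq: "emeasure \<mu> X = emeasure \<nu> X \<and> emeasure \<mu> X \<noteq> \<infinity>" if X: "X \<in> ?E" for X
  proof -
    from X obtain A B where AB: "X = A \<times> void_event B" "A \<in> sets borel" "bounded A" "B \<in> sets borel" "bounded B"
      by auto
    have "X \<in> ?S" using X unfolding S_gen by (rule sigma_sets.Basic)
    then have 1: "emeasure \<mu> X = ennreal l * (emeasure lborel A * emeasure P (void_event B))"
      by (simp add: \<mu> AB nn_integral_palm_sum_rectangle)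
    have "emeasure \<nu> X = ennreal l * (emeasure lborel A * emeasure P (void_event B))"
      unfolding \<nu>_def AB(1) using AB by (simp add: emeasure_pair_measure_Times void_event_sets)
    moreover have "emeasure lborel A \<noteq> \<infinity>" using emeasure_bounded_finite[OF AB(3)] by auto
    ultimately show ?thesis using 1 by (simp add: ennreal_mult_eq_top_iff)
  qed
  have "\<mu> = \<nu>"
  proof (rule measure_eqI_generator_eq[where E="?E" and \<Omega>="?\<Omega>" and A="\<lambda>n. ball 0 (real n) \<times> void_event {}"])
    show "Int_stable ?E"
    proof (rule Int_stableI, clarify)
      fix A B C D :: "plane set"
      assume "A \<in> sets borel" "bounded A" "B \<in> sets borel" "bounded B"
        "C \<in> sets borel" "bounded C" "D \<in> sets borel" "bounded D"
      moreover have "void_event B \<inter> void_event D = void_event (B \<union> D)"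
        by (auto simp: void_event_def)
      ultimately show "\<exists>F V. A \<times> void_event B \<inter> C \<times> void_event D = F \<times> V \<and>
          F \<in> {A. A \<in> sets borel \<and> bounded A} \<and> V \<in> {void_event B |B. B \<in> sets borel \<and> bounded B}"
        by (intro exI[of _ "A \<inter> C"] exI[of _ "void_event (B \<union> D)"]) auto
    qed
    have "ball 0 (real n) \<times> void_event {} \<in> ?E" for n
      by (intro CollectI exI[of _ "ball 0 (real n)"] exI[of _ "void_event {}"]) auto
    then show "range (\<lambda>n. ball 0 (real n) \<times> void_event {}) \<subseteq> ?E" by auto
    then show "emeasure \<mu> (ball 0 (real n) \<times> void_event {}) \<noteq> \<infinity>" for n using eq by blast
    show "(\<Union>n. ball 0 (real n) \<times> void_event {}) = ?\<Omega>"
      using reals_Archimedean2 by (auto simp: void_event_def)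
  qed (use eq S_gen in \<open>auto simp: void_event_def\<close>)
  have "(\<integral>\<^sup>+\<phi>. palm_sum f \<phi> \<partial>P) = integral\<^sup>N \<mu> f"
    using f
  proof (induction rule: borel_measurable_induct)
    case (cong f g)
    have "palm_sum f \<phi> = palm_sum g \<phi>" if "\<phi> \<in> space P" for \<phi>
      unfolding palm_sum_def using cong(3) that locally_finite_subset[of \<phi>]
      by (intro nn_integral_cong) (auto simp: space_pair_measure)
    then have "integral\<^sup>N P (palm_sum f) = integral\<^sup>N P (palm_sum g)"
      by (intro nn_integral_cong)
    moreover have "integral\<^sup>N \<mu> f = integral\<^sup>N \<mu> g"
      using cong(3) sets_eq_imp_space_eq[OF sets_\<mu>] by (intro nn_integral_cong) auto
    ultimately show ?case using cong(4) by simp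
  next
    case (set A)
    then show ?case using \<mu>[of A] by simp
  next
    case (mult u c)
    have "palm_sum (\<lambda>a. c * u a) = (\<lambda>\<phi>. c * palm_sum u \<phi>)"
      by (rule ext) (simp add: palm_sum_def nn_integral_cmult)
    with mult show ?case by (simp add: nn_integral_cmult)
  next
    case (add u v)
    have "palm_sum (\<lambda>a. v a + u a) = (\<lambda>\<phi>. palm_sum v \<phi> + palm_sum u \<phi>)"
      by (rule ext) (simp add: palm_sum_def nn_integral_add)
    with add show ?case by (simp add: nn_integral_add)
  next
    case (seq U)
    have *: "palm_sum (SUP i. U i) \<phi> = (SUP i. palm_sum (U i) \<phi>)" for \<phi>
      using seq(3) unfolding SUP_apply palm_sum_def
      by (intro nn_integral_monotone_convergence_SUP) (auto simp: incseq_def le_fun_def)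
    have inc: "incseq (\<lambda>i. palm_sum (U i))"
      using seq(3) unfolding palm_sum_def incseq_def le_fun_def by (auto intro!: nn_integral_mono)
    have "integral\<^sup>N P (palm_sum (SUP i. U i)) = (\<integral>\<^sup>+\<phi>. (SUP i. palm_sum (U i) \<phi>) \<partial>P)"
      unfolding * ..
    also have "\<dots> = (SUP i. integral\<^sup>N P (palm_sum (U i)))"
      using seq(1) inc by (intro nn_integral_monotone_convergence_SUP) auto
    also have "\<dots> = (SUP i. integral\<^sup>N \<mu> (U i))" using seq by simp
    also have "\<dots> = (\<integral>\<^sup>+p. (SUP i. U i p) \<partial>\<mu>)"
      using seq(1,3) by (intro nn_integral_monotone_convergence_SUP[symmetric]) auto
    also have "(\<lambda>p. SUP i. U i p) = (SUP i. U i)" by (rule ext) (simp only: SUP_apply)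
    finally show ?case using seq by simp
  qed
  also have "\<dots> = ennreal l * integral\<^sup>N (lborel \<Otimes>\<^sub>M P) f"
    unfolding \<open>\<mu> = \<nu>\<close> \<nu>_def using f by (subst nn_integral_scale_measure) auto
  also have "integral\<^sup>N (lborel \<Otimes>\<^sub>M P) f = (\<integral>\<^sup>+x. \<integral>\<^sup>+\<phi>. f (x, \<phi>) \<partial>P \<partial>lborel)"
    using f by (intro nn_integral_fst[symmetric]) simp
  finally show ?thesis .
qed

text \<open>The first application of the Mecke formula replaces what remains after removing
  \<open>x\<close> by a full Poisson configuration, to which the formula applies again with
  \<open>x\<close> fixed.\<close>

lemma nn_integral_palm_sum2:
  assumes g: "g \<in> borel_measurable (borel \<Otimes>\<^sub>M (borel \<Otimes>\<^sub>M P))"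
  shows "(\<integral>\<^sup>+\<phi>. palm_sum (\<lambda>(x, \<psi>). palm_sum (\<lambda>p. g (x, p)) \<psi>) \<phi> \<partial>P) =
    ennreal l * (ennreal l * (\<integral>\<^sup>+x. \<integral>\<^sup>+y. \<integral>\<^sup>+\<phi>. g (x, y, \<phi>) \<partial>P \<partial>lborel \<partial>lborel))"
proof -
  have "(\<lambda>(x, \<psi>). palm_sum (\<lambda>p. g (x, p)) \<psi>) \<in> borel_measurable (borel \<Otimes>\<^sub>M P)"
  proof -
    have m: "(\<lambda>(s, p). (fst s, p)) \<in> measurable ((borel \<Otimes>\<^sub>M P) \<Otimes>\<^sub>M (borel \<Otimes>\<^sub>M P)) (borel \<Otimes>\<^sub>M (borel \<Otimes>\<^sub>M P))"
      by measurable
    have "(\<lambda>s. palm_sum (\<lambda>p. (\<lambda>(s, p). g (fst s, p)) (s, p)) (snd s)) \<in> borel_measurable (borel \<Otimes>\<^sub>M P)"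
      using measurable_compose[OF m g] measurable_compose[OF measurable_snd id_measurable_P]
      by (intro measurable_palm_sum) (auto simp: split_beta')
    then show ?thesis by (simp add: split_beta')
  qed
  then have "(\<integral>\<^sup>+\<phi>. palm_sum (\<lambda>(x, \<psi>). palm_sum (\<lambda>p. g (x, p)) \<psi>) \<phi> \<partial>P) =
      ennreal l * (\<integral>\<^sup>+x. \<integral>\<^sup>+\<phi>. palm_sum (\<lambda>p. g (x, p)) \<phi> \<partial>P \<partial>lborel)"
    by (subst nn_integral_palm_sum) auto
  also have "(\<integral>\<^sup>+x. \<integral>\<^sup>+\<phi>. palm_sum (\<lambda>p. g (x, p)) \<phi> \<partial>P \<partial>lborel) =
      (\<integral>\<^sup>+x. ennreal l * (\<integral>\<^sup>+y. \<integral>\<^sup>+\<phi>. g (x, y, \<phi>) \<partial>P \<partial>lborel) \<partial>lborel)"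
    using g by (intro nn_integral_cong nn_integral_palm_sum) simp
  also have "\<dots> = ennreal l * (\<integral>\<^sup>+x. \<integral>\<^sup>+y. \<integral>\<^sup>+\<phi>. g (x, y, \<phi>) \<partial>P \<partial>lborel \<partial>lborel)"
  proof (rule nn_integral_cmult)
    have "(\<lambda>p. g (fst (fst p), snd (fst p), snd p)) \<in> borel_measurable ((borel \<Otimes>\<^sub>M borel) \<Otimes>\<^sub>M P)"
      using g by measurable
    then have "(\<lambda>p. \<integral>\<^sup>+\<phi>. g (fst p, snd p, \<phi>) \<partial>P) \<in> borel_measurable (borel \<Otimes>\<^sub>M lborel)"
      using borel_measurable_nn_integral_fst by fastforce
    from lborel.borel_measurable_nn_integral_fst[OF this]
    show "(\<lambda>x. \<integral>\<^sup>+y. \<integral>\<^sup>+\<phi>. g (x, y, \<phi>) \<partial>P \<partial>lborel) \<in> borel_measurable lborel" by simp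
  qed
  finally show ?thesis .
qed

end

section \<open>Points seeing a Delaunay pair under a given angle\<close>

lemma to_complex_simps:
  "to_complex (v + w) = to_complex v + to_complex w"
  "to_complex (v - w) = to_complex v - to_complex w"
  "to_complex (r *\<^sub>R v) = of_real r * to_complex v"
  by (simp_all add: to_complex_def complex_eq_iff)

lemma to_complex_eq_iff [simp]: "to_complex v = to_complex w \<longleftrightarrow> v = w"
  by (auto simp: to_complex_def vec_eq_iff forall_2)

lemma norm_to_complex: "cmod (to_complex v) = norm v"
  by (simp add: to_complex_def cmod_def norm_vec_def L2_set_def sum_2)

lemma measurable_component [measurable (raw)]:
  "f \<in> borel_measurable N \<Longrightarrow> (\<lambda>x. (f x :: plane) $ i) \<in> borel_measurable N"
  by (rule measurable_compose[OF _ borel_measurable_nth])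

text \<open>Complex multiplication carried over to \<open>real ^ 2\<close>, so that rotations act on
  the space where area and determinants are taken.\<close>

definition cmult :: "complex \<Rightarrow> plane \<Rightarrow> plane" where
  "cmult c v = vector [Re c * v $ 1 - Im c * v $ 2, Im c * v $ 1 + Re c * v $ 2]"

lemma to_complex_cmult: "to_complex (cmult c v) = c * to_complex v"
  by (simp add: cmult_def to_complex_def complex_eq_iff)

lemma cmult_cmult: "cmult c (cmult d v) = cmult (c * d) v"
  unfolding to_complex_eq_iff[symmetric] to_complex_cmult by (simp add: mult.assoc)

lemma cmult_add: "cmult c (v + w) = cmult c v + cmult c w"
  and cmult_diff: "cmult c (v - w) = cmult c v - cmult c w"
  and cmult_scaleR: "cmult c (r *\<^sub>R v) = r *\<^sub>R cmult c v"
  and cmult_diff_left: "cmult (c - d) v = cmult c v - cmult d v"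
  and cmult_1: "cmult 1 v = v"
  unfolding to_complex_eq_iff[symmetric] to_complex_cmult to_complex_simps
  by (simp_all add: algebra_simps)

lemma norm_cmult: "norm (cmult c v) = cmod c * norm v"
  by (simp add: norm_to_complex[symmetric] to_complex_cmult norm_mult)

lemma linear_cmult: "linear (cmult c)"
  by (rule linearI) (simp_all add: cmult_add cmult_scaleR)

lemma continuous_cmult [continuous_intros]:
  "continuous_on S f \<Longrightarrow> continuous_on S (\<lambda>x. cmult c (f x))"
  using continuous_on_compose[OF _ linear_continuous_on[OF linear_conv_bounded_linear[THEN iffD1, OF linear_cmult]]]
  by (simp add: o_def)

lemma measurable_cmult [measurable (raw)]:
  "f \<in> borel_measurable N \<Longrightarrow> (\<lambda>x. cmult c (f x)) \<in> borel_measurable N"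
proof -
  have "cmult c \<in> borel_measurable borel"
    by (rule borel_measurable_continuous_onI, rule continuous_cmult[OF continuous_on_id])
  then show "f \<in> borel_measurable N \<Longrightarrow> (\<lambda>x. cmult c (f x)) \<in> borel_measurable N"
    by (rule measurable_compose[rotated])
qed

text \<open>On the bisector of \<open>X\<close> and \<open>Y\<close>, the clockwise angle from \<open>X\<close> to \<open>Y\<close> is \<open>\<theta>\<close> exactly when
  \<open>Y - Z = cis (-\<theta>) * (X - Z)\<close>; the apex is the solution \<open>Z\<close>.\<close>

definition apex :: "real \<Rightarrow> plane \<Rightarrow> plane \<Rightarrow> plane" where
  "apex \<theta> X Y = cmult (1 / (1 - cis (- \<theta>))) (Y - cmult (cis (- \<theta>)) X)"

lemma measurable_apex [measurable (raw)]:
  "f \<in> borel_measurable N \<Longrightarrow> g \<in> borel_measurable N \<Longrightarrow> (\<lambda>x. apex \<theta> (f x) (g x)) \<in> borel_measurable N"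
  unfolding apex_def by (intro measurable_cmult borel_measurable_diff)

definition bisector_point :: "real \<Rightarrow> plane \<Rightarrow> plane \<Rightarrow> real \<Rightarrow> plane" where
  "bisector_point \<theta> X Y s = apex \<theta> X Y + s *\<^sub>R cmult \<i> (Y - X)"

text \<open>\<open>X\<close> need not belong to \<phi>: under the Mecke formula the condition is
  evaluated on a configuration without \<open>X\<close>. For \<open>X\<close> in \<phi> it is
  membership in the Voronoi cell.\<close>

definition nearest :: "plane set \<Rightarrow> plane \<Rightarrow> plane \<Rightarrow> bool" where
  "nearest \<phi> X p \<longleftrightarrow> (\<forall>W\<in>\<phi>. dist p X \<le> dist p W)"

text \<open>The facet condition is phrased with countably many points of the bisector, which makes it measurable.\<close>

definition facet_at :: "real \<Rightarrow> plane \<Rightarrow> plane \<Rightarrow> plane set \<Rightarrow> bool" where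
  "facet_at \<theta> X Y \<phi> \<longleftrightarrow>
     nearest \<phi> X (apex \<theta> X Y) \<and>
     (\<exists>n. nearest \<phi> X (bisector_point \<theta> X Y (1 / real (Suc n))) \<or>
          nearest \<phi> X (bisector_point \<theta> X Y (- (1 / real (Suc n))))) \<and>
     (\<exists>n. \<not> nearest \<phi> X (bisector_point \<theta> X Y (real n))) \<and>
     (\<exists>n. \<not> nearest \<phi> X (bisector_point \<theta> X Y (- real n)))"

text \<open>Squaring cancels \<open>p \<bullet> p\<close>, which makes the comparison affine in
  \<open>p\<close>. Convexity of cells and the linear form of bisectors come from this.\<close>

lemma dist_le_iff_inner:
  fixes p :: "'a::real_inner"
  shows "dist p X \<le> dist p W \<longleftrightarrow> 2 * (p \<bullet> (W - X)) \<le> W \<bullet> W - X \<bullet> X"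
proof -
  have "dist p X \<le> dist p W \<longleftrightarrow> (p - X) \<bullet> (p - X) \<le> (p - W) \<bullet> (p - W)"
    by (simp add: dist_norm norm_le)
  also have "\<dots> \<longleftrightarrow> 2 * (p \<bullet> (W - X)) \<le> W \<bullet> W - X \<bullet> X"
    by (simp add: inner_diff_left inner_diff_right inner_commute[of X p] inner_commute[of W p])
       linarith
  finally show ?thesis .
qed

lemma dist_eq_iff_inner:
  fixes p :: "'a::real_inner"
  shows "dist p X = dist p W \<longleftrightarrow> 2 * (p \<bullet> (W - X)) = W \<bullet> W - X \<bullet> X"
proof -
  have "p \<bullet> (X - W) = - (p \<bullet> (W - X))" by (simp add: inner_diff_right)
  then show ?thesis using dist_le_iff_inner[of p X W] dist_le_iff_inner[of p W X] by linarith
qed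

section \<open>Voronoi facets as intervals on the bisector\<close>

lemma inner_cmult_ii: "cmult \<i> v \<bullet> v = 0"
  by (simp add: cmult_def inner_vec_def sum_2)

lemma orthogonal_plane:
  assumes "v \<bullet> d = 0" "d \<noteq> (0 :: plane)"
  shows "\<exists>s. v = s *\<^sub>R cmult \<i> d"
proof -
  let ?N = "(d $ 1)\<^sup>2 + (d $ 2)\<^sup>2"
  have N: "?N \<noteq> 0" using assms(2) by (auto simp: vec_eq_iff forall_2 sum_power2_eq_zero_iff)
  have o: "v $ 1 * d $ 1 + v $ 2 * d $ 2 = 0" using assms(1) by (simp add: inner_vec_def sum_2)
  \<comment> \<open>The projection coefficient of \<open>v\<close> on the quarter turn of
    \<open>d\<close>, which spans the orthogonal complement in dimension two.\<close>
  let ?s = "(v $ 2 * d $ 1 - v $ 1 * d $ 2) / ?N"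
  have "v $ 1 * ?N = - (v $ 2 * d $ 1 - v $ 1 * d $ 2) * d $ 2" using o by algebra
  moreover have "v $ 2 * ?N = (v $ 2 * d $ 1 - v $ 1 * d $ 2) * d $ 1" using o by algebra
  ultimately have "v = ?s *\<^sub>R cmult \<i> d"
    using N by (simp add: vec_eq_iff forall_2 cmult_def field_simps)
  then show ?thesis ..
qed

lemma bisector_iff:
  assumes "dist Z X = dist Z Y" "X \<noteq> (Y :: plane)"
  shows "dist p X = dist p Y \<longleftrightarrow> (\<exists>s. p = Z + s *\<^sub>R cmult \<i> (Y - X))"
proof
  assume "dist p X = dist p Y"
  then have "(p - Z) \<bullet> (Y - X) = 0"
    using assms(1) unfolding dist_eq_iff_inner by (simp add: inner_diff_left)
  then obtain s where "p - Z = s *\<^sub>R cmult \<i> (Y - X)"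
    using orthogonal_plane assms(2) by fastforce
  then show "\<exists>s. p = Z + s *\<^sub>R cmult \<i> (Y - X)" by (metis add.commute diff_add_cancel)
next
  assume "\<exists>s. p = Z + s *\<^sub>R cmult \<i> (Y - X)"
  then show "dist p X = dist p Y"
    using assms(1) unfolding dist_eq_iff_inner
    by (auto simp: inner_add_left inner_cmult_ii)
qed

lemma closed_convex_nearest_line: "closed {s. nearest \<phi> X (Z + s *\<^sub>R u)}" "convex {s. nearest \<phi> X (Z + s *\<^sub>R u)}"
proof -
  have eq: "{s. nearest \<phi> X (Z + s *\<^sub>R u)} =
      (\<Inter>W\<in>\<phi>. {s. (2 * (u \<bullet> (W - X))) * s \<le> W \<bullet> W - X \<bullet> X - 2 * (Z \<bullet> (W - X))})"
    unfolding nearest_def dist_le_iff_inner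
    by (auto simp: inner_add_left algebra_simps)
  show "closed {s. nearest \<phi> X (Z + s *\<^sub>R u)}"
    unfolding eq by (intro closed_INT ballI closed_Collect_le continuous_intros)
  show "convex {s. nearest \<phi> X (Z + s *\<^sub>R u)}"
    unfolding eq
  proof (intro convex_INT)
    fix W
    show "convex {s. (2 * (u \<bullet> (W - X))) * s \<le> W \<bullet> W - X \<bullet> X - 2 * (Z \<bullet> (W - X))}"
      using convex_halfspace_le[of "2 * (u \<bullet> (W - X))" "W \<bullet> W - X \<bullet> X - 2 * (Z \<bullet> (W - X))"] by simp
  qed
qed

lemma voronoi_cell_iff:
  assumes "X \<in> \<phi>"
  shows "p \<in> voronoi_cell \<phi> X \<longleftrightarrow> nearest \<phi> X p"
  by (auto simp: voronoi_cell_def nearest_def le_INF_iff dist_norm)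

lemma voronoi_Int_iff:
  assumes "X \<in> \<phi>" "Y \<in> \<phi>"
  shows "p \<in> voronoi_cell \<phi> X \<inter> voronoi_cell \<phi> Y \<longleftrightarrow> dist p X = dist p Y \<and> nearest \<phi> X p"
proof -
  have "nearest \<phi> X p \<Longrightarrow> nearest \<phi> Y p \<Longrightarrow> dist p X = dist p Y"
    unfolding nearest_def using assms by (meson order.antisym)
  moreover have "dist p X = dist p Y \<Longrightarrow> nearest \<phi> X p \<Longrightarrow> nearest \<phi> Y p"
    unfolding nearest_def by simp
  ultimately show ?thesis using assms by (auto simp: voronoi_cell_iff)
qed

lemma cmult_eq_0_iff [simp]: "cmult c v = 0 \<longleftrightarrow> c = 0 \<or> v = 0"
  using norm_cmult[of c v] by (metis mult_eq_0_iff norm_eq_zero)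

text \<open>On the bisector the common boundary corresponds to a closed convex parameter set
  \<open>I\<close>. A nondegenerate segment through \<open>Z\<close> means that \<open>I\<close>
  contains 0, has another point, and is bounded on both sides. By convexity the parameters
  \<open>1 / (n + 1)\<close>, \<open>n\<close> and their negatives suffice to test this.\<close>

lemma voronoi_facet_iff:
  assumes "X \<in> \<phi>" "Y \<in> \<phi>" "X \<noteq> Y" and Z: "dist Z X = dist Z Y"
  defines "u \<equiv> cmult \<i> (Y - X)"
  shows "(\<exists>S. voronoi_facet \<phi> X Y S \<and> Z \<in> S) \<longleftrightarrow>
    nearest \<phi> X Z \<and>
    (\<exists>n. nearest \<phi> X (Z + (1 / real (Suc n)) *\<^sub>R u) \<or> nearest \<phi> X (Z + (- (1 / real (Suc n))) *\<^sub>R u)) \<and>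
    (\<exists>n. \<not> nearest \<phi> X (Z + real n *\<^sub>R u)) \<and>
    (\<exists>n. \<not> nearest \<phi> X (Z + (- real n) *\<^sub>R u))"
proof -
  define I where "I = {s. nearest \<phi> X (Z + s *\<^sub>R u)}"
  define S where "S = voronoi_cell \<phi> X \<inter> voronoi_cell \<phi> Y"
  have I: "closed I" "convex I" unfolding I_def by (rule closed_convex_nearest_line)+
  have u: "u \<noteq> 0" using assms(3) by (simp add: u_def)
  have S_iff: "p \<in> S \<longleftrightarrow> (\<exists>s\<in>I. p = Z + s *\<^sub>R u)" for p
    unfolding S_def voronoi_Int_iff[OF assms(1,2)] bisector_iff[OF Z assms(3)] I_def u_def by auto
  have between: "r \<in> I" if "0 \<in> I" "s \<in> I" "0 \<le> r \<and> r \<le> s \<or> s \<le> r \<and> r \<le> 0" for r s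
    using I(2) that by (metis atLeastAtMost_iff is_interval_1 is_interval_convex_1)
  have "(\<exists>T. voronoi_facet \<phi> X Y T \<and> Z \<in> T) \<longleftrightarrow> Z \<in> S \<and> (\<exists>a b. a \<noteq> b \<and> S = closed_segment a b)"
    using assms(1-3) by (auto simp: voronoi_facet_def S_def)
  also have "\<dots> \<longleftrightarrow> 0 \<in> I \<and> (\<exists>n. 1 / real (Suc n) \<in> I \<or> - (1 / real (Suc n)) \<in> I) \<and>
      (\<exists>n. real n \<notin> I) \<and> (\<exists>n. - real n \<notin> I)"
  proof
    assume L: "Z \<in> S \<and> (\<exists>a b. a \<noteq> b \<and> S = closed_segment a b)"
    then obtain a b where ab: "a \<noteq> b" "S = closed_segment a b" by blast
    have 0: "0 \<in> I" using L u unfolding S_iff by auto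
    have "a \<in> S" "b \<in> S" using ab by auto
    then obtain p where "p \<in> S" "p \<noteq> Z" using ab(1) by metis
    then obtain s where s: "s \<in> I" "s \<noteq> 0" unfolding S_iff by auto
    obtain n where n: "1 / real (Suc n) < \<bar>s\<bar>"
      using reals_Archimedean[of "\<bar>s\<bar>"] s(2) by (auto simp: inverse_eq_divide)
    have pos: "1 / real (Suc n) > 0" by simp
    have 1: "1 / real (Suc n) \<in> I \<or> - (1 / real (Suc n)) \<in> I"
    proof (cases "s > 0")
      case True
      then have "1 / real (Suc n) \<in> I" using n pos by (intro between[OF 0 s(1)]) linarith
      then show ?thesis ..
    next
      case False
      then have "- (1 / real (Suc n)) \<in> I" using n pos by (intro between[OF 0 s(1)]) linarith
      then show ?thesis ..
    qed
    have "bounded S" unfolding ab(2) by (intro compact_imp_bounded compact_segment)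
    then obtain R where R: "\<And>p. p \<in> S \<Longrightarrow> norm p \<le> R" unfolding bounded_iff by blast
    obtain m :: nat where m: "real m > (R + norm Z) / norm u" using reals_Archimedean2 by blast
    have "\<bar>r\<bar> * norm u \<le> R + norm Z" if "r \<in> I" for r
    proof -
      have "norm (Z + r *\<^sub>R u) \<le> R" using R that S_iff by blast
      moreover have "norm (r *\<^sub>R u) \<le> norm (Z + r *\<^sub>R u) + norm Z"
        using norm_triangle_ineq4[of "Z + r *\<^sub>R u" Z] by simp
      ultimately show ?thesis by simp
    qed
    from this[of "real m"] this[of "- real m"] have "real m \<notin> I" "- real m \<notin> I"
      using m u by (auto simp: field_simps)
    with 0 1 show "0 \<in> I \<and> (\<exists>n. 1 / real (Suc n) \<in> I \<or> - (1 / real (Suc n)) \<in> I) \<and>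
      (\<exists>n. real n \<notin> I) \<and> (\<exists>n. - real n \<notin> I)" by blast
  next
    assume R: "0 \<in> I \<and> (\<exists>n. 1 / real (Suc n) \<in> I \<or> - (1 / real (Suc n)) \<in> I) \<and>
      (\<exists>n. real n \<notin> I) \<and> (\<exists>n. - real n \<notin> I)"
    then have 0: "0 \<in> I" by blast
    from R obtain n k m where nkm: "1 / real (Suc k) \<in> I \<or> - (1 / real (Suc k)) \<in> I"
      "real n \<notin> I" "- real m \<notin> I" by blast
    have "I \<subseteq> {- real m..real n}"
    proof
      fix r assume r: "r \<in> I"
      have "\<not> r > real n" using between[OF 0 r, of "real n"] nkm(2) by auto
      moreover have "\<not> r < - real m" using between[OF 0 r, of "- real m"] nkm(3) by auto
      ultimately show "r \<in> {- real m..real n}" by simp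
    qed
    then have "compact I" using I(1) by (meson bounded_closed_interval bounded_subset compact_eq_bounded_closed)
    then obtain a b where ab: "I = {a..b}"
      using I(2) connected_compact_interval_1 convex_connected by metis
    obtain r where r: "r \<in> I" "r \<noteq> 0" using nkm(1) by (metis divide_eq_0_iff nat.distinct(1) neg_equal_0_iff_equal of_nat_eq_0_iff zero_neq_one)
    have "a < b" using 0 r unfolding ab by auto
    have "S = (\<lambda>x. Z + x) ` (\<lambda>s. s *\<^sub>R u) ` closed_segment a b"
    proof -
      have "S = (\<lambda>s. Z + s *\<^sub>R u) ` I" using S_iff by blast
      then show ?thesis using \<open>a < b\<close> by (simp add: ab closed_segment_eq_real_ivl image_image)
    qed
    also have "\<dots> = closed_segment (Z + a *\<^sub>R u) (Z + b *\<^sub>R u)"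
      by (simp add: closed_segment_translation closed_segment_linear_image[of "\<lambda>s. s *\<^sub>R u"] linear_scaleR_left)
    finally have "S = closed_segment (Z + a *\<^sub>R u) (Z + b *\<^sub>R u)" .
    moreover have "Z + a *\<^sub>R u \<noteq> Z + b *\<^sub>R u" using \<open>a < b\<close> u by simp
    moreover have "Z \<in> S" using 0 S_iff[of Z] by force
    ultimately show "Z \<in> S \<and> (\<exists>a b. a \<noteq> b \<and> S = closed_segment a b)" by blast
  qed
  finally show ?thesis unfolding I_def mem_Collect_eq by simp
qed

lemma measurable_nearest:
  assumes "\<Phi> \<in> measurable N configurations" "f \<in> borel_measurable N" "g \<in> borel_measurable N"
  shows "Measurable.pred N (\<lambda>s. nearest (\<Phi> s) (f s) (g s))"
  unfolding nearest_def
  by (rule pred_all_configuration[OF assms(1)]) (use assms(2,3) in measurable)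

lemma nearest_shift: "nearest (shift t \<phi>) (X + t) (p + t) \<longleftrightarrow> nearest \<phi> X p"
  by (auto simp: nearest_def shift_def)

section \<open>Ordered pairs and their apices\<close>

locale angle =
  fixes \<theta> :: real
  assumes \<theta>: "0 < \<theta>" "\<theta> < 2 * pi"
begin

abbreviation q :: complex where "q \<equiv> cis (- \<theta>)"

lemma q_neq_1: "q \<noteq> 1"
proof
  assume "q = 1"
  then have "cos \<theta> = 1" by (simp add: complex_eq_iff)
  then obtain n :: int where n: "\<theta> = of_int n * 2 * pi" using cos_one_2pi_int by auto
  then have "0 < n" "n < 1" using \<theta> by (auto simp: zero_less_mult_iff)
  then show False by simp
qed

lemma one_minus_q [simp]: "1 - q \<noteq> 0" using q_neq_1 by simp

text \<open>The apex is the centre of the rotation by -\<theta> carrying \<open>X\<close> to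
  \<open>Y\<close>; it is unique because this rotation is not the identity.\<close>

lemma apex_iff: "Z = apex \<theta> X Y \<longleftrightarrow> Y - Z = cmult q (X - Z)"
proof -
  have "Z = apex \<theta> X Y \<longleftrightarrow> to_complex Z * (1 - q) = to_complex Y - q * to_complex X"
    unfolding to_complex_eq_iff[symmetric] apex_def to_complex_cmult to_complex_simps
    by (simp add: nonzero_eq_divide_eq[OF one_minus_q])
  also have "\<dots> \<longleftrightarrow> Y - Z = cmult q (X - Z)"
    unfolding to_complex_eq_iff[symmetric] to_complex_cmult to_complex_simps
    by (auto simp: algebra_simps)
  finally show ?thesis .
qed

lemma apex_eq: "Y - apex \<theta> X Y = cmult q (X - apex \<theta> X Y)"
  using apex_iff by blast

lemma dist_apex: "dist (apex \<theta> X Y) X = dist (apex \<theta> X Y) Y"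
  using arg_cong[OF apex_eq[of Y X], of norm] by (simp add: norm_cmult dist_norm norm_minus_commute)

text \<open>Equal distances make the quotient defining the angle a unit complex number, which its
  argument determines. The range of \<theta> makes it its own representative modulo
  \<open>2 * pi\<close>.\<close>

lemma cw_angle_iff:
  assumes "X \<noteq> Y" "dist Z X = dist Z Y"
  shows "[cw_angle X Z Y = \<theta>] (rmod (2 * pi)) \<longleftrightarrow> Z = apex \<theta> X Y"
proof -
  define w where "w = to_complex (X - Z) / to_complex (Y - Z)"
  have "Y \<noteq> Z" using assms by auto
  then have yz: "to_complex (Y - Z) \<noteq> 0"
    by (metis norm_eq_zero norm_to_complex right_minus_eq)
  have "cmod w = 1"
    using assms(2) \<open>Y \<noteq> Z\<close> by (simp add: w_def norm_divide norm_to_complex dist_norm norm_minus_commute)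
  have "Arg2pi w rmod (2 * pi) = Arg2pi w" "\<theta> rmod (2 * pi) = \<theta>"
    using \<theta> Arg2pi_ge_0[of w] Arg2pi_lt_2pi[of w] by (auto intro!: rmod_unique[where n=0])
  then have "[cw_angle X Z Y = \<theta>] (rmod (2 * pi)) \<longleftrightarrow> Arg2pi w = \<theta>"
    by (simp add: rcong_def cw_angle_def w_def)
  also have "\<dots> \<longleftrightarrow> w = cis \<theta>"
    using \<open>cmod w = 1\<close> complex_norm_eq_1_exp[of w] Arg2pi_unique[of 1 \<theta> w] \<theta>
    by (auto simp: cis_conv_exp)
  also have "\<dots> \<longleftrightarrow> to_complex (Y - Z) = q * to_complex (X - Z)"
    using yz by (auto simp: w_def field_simps cis_mult)
  also have "\<dots> \<longleftrightarrow> Y - Z = cmult q (X - Z)"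
    by (simp flip: to_complex_cmult)
  finally show ?thesis by (simp add: apex_iff)
qed

lemma angle_points_eq:
  "angle_points \<theta> \<phi> =
    {apex \<theta> X Y | X Y. X \<in> \<phi> \<and> Y \<in> \<phi> \<and> X $ 1 < Y $ 1 \<and> facet_at \<theta> X Y \<phi>}"
proof (intro set_eqI iffI)
  fix Z assume "Z \<in> angle_points \<theta> \<phi>"
  then obtain S X Y where *: "voronoi_facet \<phi> X Y S" "X $ 1 < Y $ 1" "Z \<in> S"
      "[cw_angle X Z Y = \<theta>] (rmod (2 * pi))"
    by (auto simp: angle_points_def)
  have XY: "X \<in> \<phi>" "Y \<in> \<phi>" "X \<noteq> Y" and "S = voronoi_cell \<phi> X \<inter> voronoi_cell \<phi> Y"
    using *(1) by (auto simp: voronoi_facet_def)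
  then have "dist Z X = dist Z Y" using *(3) voronoi_Int_iff by blast
  then have Z: "Z = apex \<theta> X Y" using *(4) XY(3) cw_angle_iff by blast
  have "facet_at \<theta> X Y \<phi>"
    using voronoi_facet_iff[OF XY dist_apex[of X Y]] *(1,3)
    unfolding facet_at_def bisector_point_def Z by blast
  then show "Z \<in> {apex \<theta> X Y | X Y. X \<in> \<phi> \<and> Y \<in> \<phi> \<and> X $ 1 < Y $ 1 \<and> facet_at \<theta> X Y \<phi>}"
    using Z XY *(2) by blast
next
  fix Z assume "Z \<in> {apex \<theta> X Y | X Y. X \<in> \<phi> \<and> Y \<in> \<phi> \<and> X $ 1 < Y $ 1 \<and> facet_at \<theta> X Y \<phi>}"
  then obtain X Y where *: "Z = apex \<theta> X Y" "X \<in> \<phi>" "Y \<in> \<phi>" "X $ 1 < Y $ 1" "facet_at \<theta> X Y \<phi>"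
    by blast
  then have "X \<noteq> Y" by auto
  obtain S where "voronoi_facet \<phi> X Y S" "Z \<in> S"
    using voronoi_facet_iff[OF *(2,3) \<open>X \<noteq> Y\<close> dist_apex[of X Y]] *(5)
    unfolding facet_at_def bisector_point_def *(1) by blast
  then show "Z \<in> angle_points \<theta> \<phi>"
    using cw_angle_iff[OF \<open>X \<noteq> Y\<close> dist_apex[of X Y]] *(1,4) unfolding angle_points_def by blast
qed

text \<open>An apex in a bounded window is within bounded distance of a fixed point \<open>W\<close>
  of \<phi>, hence of the pair nearest to it. Only finitely many pairs remain.\<close>

lemma angle_points_locally_finite:
  assumes "\<phi> \<in> locally_finite_sets"
  shows "angle_points \<theta> \<phi> \<in> locally_finite_sets"
  unfolding locally_finite_sets_def
proof clarify
  fix B :: "plane set" assume "bounded B"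
  show "finite (angle_points \<theta> \<phi> \<inter> B)"
  proof (cases "\<phi> = {}")
    case True
    then show ?thesis by (simp add: angle_points_eq)
  next
    case False
    then obtain W where W: "W \<in> \<phi>" by blast
    obtain R where R: "\<And>p. p \<in> B \<Longrightarrow> norm p \<le> R" using \<open>bounded B\<close> unfolding bounded_iff by blast
    \<comment> \<open>The apex has norm at most \<open>R\<close>, and its distance to the pair is at
      most that to \<open>W\<close>, hence at most \<open>R + norm W\<close>.\<close>
    let ?C = "\<phi> \<inter> cball 0 (2 * R + norm W)"
    have "X \<in> ?C \<and> Y \<in> ?C" if "X \<in> \<phi>" "Y \<in> \<phi>" "facet_at \<theta> X Y \<phi>" "apex \<theta> X Y \<in> B" for X Y
    proof -
      let ?Z = "apex \<theta> X Y"
      have "dist ?Z X \<le> dist ?Z W" using that(3) W by (auto simp: facet_at_def nearest_def)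
      also have "\<dots> \<le> R + norm W" using R[OF that(4)] norm_triangle_ineq4[of ?Z W] by (simp add: dist_norm)
      finally have "dist ?Z X \<le> R + norm W" "dist ?Z Y \<le> R + norm W" using dist_apex[of X Y] by simp_all
      moreover have "norm X \<le> norm ?Z + dist ?Z X" "norm Y \<le> norm ?Z + dist ?Z Y"
        using norm_triangle_ineq4[of ?Z "?Z - X"] norm_triangle_ineq4[of ?Z "?Z - Y"] by (simp_all add: dist_norm)
      ultimately show ?thesis using that R[OF that(4)] by auto
    qed
    then have "angle_points \<theta> \<phi> \<inter> B \<subseteq> (\<lambda>(X, Y). apex \<theta> X Y) ` (?C \<times> ?C)"
      unfolding angle_points_eq by (fastforce simp: image_iff)
    moreover have "finite ?C" using assms by (rule locally_finiteD) simp
    ultimately show ?thesis by (meson finite_SigmaI finite_imageI finite_subset)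
  qed
qed

lemma apex_translate: "apex \<theta> (X + t) (Y + t) = apex \<theta> X Y + t"
  using apex_eq[of Y X] by (metis add_diff_cancel_right apex_iff)

lemma facet_at_shift: "facet_at \<theta> (X + t) (Y + t) (shift t \<phi>) \<longleftrightarrow> facet_at \<theta> X Y \<phi>"
proof -
  have "bisector_point \<theta> (X + t) (Y + t) s = bisector_point \<theta> X Y s + t" for s
    by (simp add: bisector_point_def apex_translate)
  then show ?thesis by (simp add: facet_at_def apex_translate nearest_shift)
qed

lemma angle_points_shift: "angle_points \<theta> (shift t \<phi>) = shift t (angle_points \<theta> \<phi>)"
proof (intro set_eqI iffI)
  fix Z assume "Z \<in> angle_points \<theta> (shift t \<phi>)"
  then obtain X Y where "Z = apex \<theta> (X + t) (Y + t)" "X \<in> \<phi>" "Y \<in> \<phi>" "(X + t) $ 1 < (Y + t) $ 1"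
      "facet_at \<theta> (X + t) (Y + t) (shift t \<phi>)"
    unfolding angle_points_eq by (auto simp: shift_def)
  then show "Z \<in> shift t (angle_points \<theta> \<phi>)"
    unfolding angle_points_eq facet_at_shift apex_translate by (auto simp: shift_def)
next
  fix Z assume "Z \<in> shift t (angle_points \<theta> \<phi>)"
  then obtain X Y where *: "Z = apex \<theta> X Y + t" "X \<in> \<phi>" "Y \<in> \<phi>" "X $ 1 < Y $ 1" "facet_at \<theta> X Y \<phi>"
    unfolding angle_points_eq by (auto simp: shift_def)
  then have "X + t \<in> shift t \<phi>" "Y + t \<in> shift t \<phi>" "(X + t) $ 1 < (Y + t) $ 1"
    by (auto simp: shift_def)
  then show "Z \<in> angle_points \<theta> (shift t \<phi>)"
    unfolding angle_points_eq *(1) using *(5)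
    by (intro CollectI exI[of _ "X + t"] exI[of _ "Y + t"]) (simp add: facet_at_shift apex_translate)
qed

lemma measurable_facet_at:
  assumes \<Phi>: "\<Phi> \<in> measurable N configurations"
    and [measurable]: "f \<in> borel_measurable N" "g \<in> borel_measurable N"
  shows "Measurable.pred N (\<lambda>s. facet_at \<theta> (f s) (g s) (\<Phi> s))"
proof -
  have [measurable]: "Measurable.pred N (\<lambda>s. nearest (\<Phi> s) (f s) (bisector_point \<theta> (f s) (g s) r))" for r
    unfolding bisector_point_def by (rule measurable_nearest[OF \<Phi>]) measurable
  have [measurable]: "Measurable.pred N (\<lambda>s. nearest (\<Phi> s) (f s) (apex \<theta> (f s) (g s)))"
    by (rule measurable_nearest[OF \<Phi>]) measurable
  show ?thesis unfolding facet_at_def by measurable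
qed

text \<open>A void event of the image says that no pair of points of \<phi> satisfies a measurable
  condition: two nested quantifiers over the configuration.\<close>

lemma measurable_angle_points [measurable]: "angle_points \<theta> \<in> measurable configurations configurations"
proof (rule measurable_configurationsI)
  fix B :: "plane set" assume [measurable]: "B \<in> sets borel"
  let ?P = "\<lambda>X Y \<phi>. X $ 1 < Y $ 1 \<and> facet_at \<theta> X Y \<phi> \<and> apex \<theta> X Y \<in> B"
  have [measurable]: "Measurable.pred ((configurations \<Otimes>\<^sub>M borel) \<Otimes>\<^sub>M borel) (\<lambda>p. facet_at \<theta> (snd (fst p)) (snd p) (fst (fst p)))"
    by (rule measurable_facet_at) auto
  have "Measurable.pred ((configurations \<Otimes>\<^sub>M borel) \<Otimes>\<^sub>M borel)
      (\<lambda>(p, Y). ?P (snd p) Y (fst p))"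
    unfolding split_beta' by measurable
  then have "Measurable.pred (configurations \<Otimes>\<^sub>M borel) (\<lambda>p. \<exists>Y\<in>fst p. ?P (snd p) Y (fst p))"
    by (intro pred_ex_configuration) auto
  then have "Measurable.pred configurations (\<lambda>\<phi>. \<exists>X\<in>\<phi>. \<exists>Y\<in>\<phi>. ?P X Y \<phi>)"
    by (intro pred_ex_configuration) (auto simp: split_beta')
  then have "{\<phi> \<in> space configurations. \<not> (\<exists>X\<in>\<phi>. \<exists>Y\<in>\<phi>. ?P X Y \<phi>)} \<in> sets configurations"
    by measurable
  also have "{\<phi> \<in> space configurations. \<not> (\<exists>X\<in>\<phi>. \<exists>Y\<in>\<phi>. ?P X Y \<phi>)} =
      {\<phi> \<in> space configurations. angle_points \<theta> \<phi> \<inter> B = {}}"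
    unfolding angle_points_eq by blast
  finally show "{\<phi> \<in> space configurations. angle_points \<theta> \<phi> \<inter> B = {}} \<in> sets configurations" .
qed (simp add: space_configurations angle_points_locally_finite)

end

section \<open>Gaussian integrals over pairs of points\<close>

lemma det_matrix_cmult: "det (matrix (cmult c)) = (cmod c)\<^sup>2"
  by (simp add: det_2 matrix_def cmult_def axis_def cmod_power2) (simp add: power2_eq_square)

lemma nn_integral_lborel_translate:
  fixes b :: "'a::euclidean_space"
  assumes [measurable]: "f \<in> borel_measurable borel"
  shows "(\<integral>\<^sup>+x. f (x + b) \<partial>lborel) = (\<integral>\<^sup>+x. f x \<partial>lborel)"
proof -
  have "(\<integral>\<^sup>+x. f x \<partial>lborel) = (\<integral>\<^sup>+x. f x \<partial>distr lborel borel ((+) b))" by (simp add: lborel_distr_plus)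
  also have "\<dots> = (\<integral>\<^sup>+x. f (x + b) \<partial>lborel)" by (subst nn_integral_distr) (auto simp: add.commute)
  finally show ?thesis ..
qed

text \<open>Multiplication by \<open>c\<close> has real determinant \<open>|c|^2\<close>. Boxes
  characterize Lebesgue measure, and their preimages are images under multiplication by
  \<open>1 / c\<close>.\<close>

lemma lborel_cmult:
  assumes "c \<noteq> 0"
  shows "lborel = density (distr lborel borel (cmult c)) (\<lambda>_. ennreal ((cmod c)\<^sup>2))"
proof (rule lborel_eqI)
  fix l u :: plane assume lu: "\<And>b. b \<in> Basis \<Longrightarrow> l \<bullet> b \<le> u \<bullet> b"
  have inv: "cmult (1 / c) (cmult c v) = v" "cmult c (cmult (1 / c) v) = v" for v
    using assms by (simp_all add: cmult_cmult cmult_1)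
  have eq: "cmult c -` box l u = cmult (1 / c) ` box l u"
    by (auto simp: inv image_iff) (metis inv(1))
  have [measurable]: "cmult c -` box l u \<in> sets borel"
    using measurable_sets[of "cmult c" borel borel "box l u"] by simp
  have box: "box l u \<in> lmeasurable" by simp
  have "cmult c -` box l u \<in> lmeasurable"
    unfolding eq by (rule measurable_linear_image[OF linear_cmult box])
  then have fin: "emeasure lborel (cmult c -` box l u) \<noteq> \<top>"
    by (auto simp: fmeasurable_def)
  have "measure lborel (cmult c -` box l u) = measure lebesgue (cmult c -` box l u)"
    by simp
  also have "\<dots> = (cmod (1 / c))\<^sup>2 * measure lebesgue (box l u)"
    unfolding eq by (subst measure_linear_image[OF linear_cmult box]) (simp add: det_matrix_cmult)
  finally have m: "measure lborel (cmult c -` box l u) = (cmod (1 / c))\<^sup>2 * measure lborel (box l u)"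
    by simp
  have "emeasure (density (distr lborel borel (cmult c)) (\<lambda>_. ennreal ((cmod c)\<^sup>2))) (box l u) =
      ennreal ((cmod c)\<^sup>2) * emeasure lborel (cmult c -` box l u)"
    by (simp add: emeasure_density nn_integral_cmult emeasure_distr)
  also have "\<dots> = ennreal ((cmod c)\<^sup>2 * ((cmod (1 / c))\<^sup>2 * measure lborel (box l u)))"
    unfolding emeasure_eq_ennreal_measure[OF fin] m by (simp add: ennreal_mult')
  also have "(cmod c)\<^sup>2 * ((cmod (1 / c))\<^sup>2 * measure lborel (box l u)) = measure lborel (box l u)"
    using assms by (simp add: norm_divide power_divide)
  also have "ennreal (measure lborel (box l u)) = ennreal (\<Prod>b\<in>Basis. (u - l) \<bullet> b)"
    using lu by (simp add: measure_lborel_box)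
  finally show "emeasure (density (distr lborel borel (cmult c)) (\<lambda>_. ennreal ((cmod c)\<^sup>2))) (box l u) =
      ennreal (\<Prod>b\<in>Basis. (u - l) \<bullet> b)" .
qed simp

lemma nn_integral_cmult_affine:
  assumes [measurable]: "f \<in> borel_measurable borel" and "c \<noteq> 0"
  shows "(\<integral>\<^sup>+y. f y \<partial>lborel) = ennreal ((cmod c)\<^sup>2) * (\<integral>\<^sup>+z. f (cmult c z + b) \<partial>lborel)"
proof -
  have "(\<integral>\<^sup>+y. f y \<partial>lborel) = (\<integral>\<^sup>+y. f (y + b) \<partial>lborel)"
    by (rule nn_integral_lborel_translate[symmetric]) simp
  also have "\<dots> = (\<integral>\<^sup>+y. f (y + b) \<partial>density (distr lborel borel (cmult c)) (\<lambda>_. ennreal ((cmod c)\<^sup>2)))"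
    using lborel_cmult[OF assms(2)] by simp
  also have "\<dots> = ennreal ((cmod c)\<^sup>2) * (\<integral>\<^sup>+z. f (cmult c z + b) \<partial>lborel)"
    by (simp add: nn_integral_density nn_integral_distr nn_integral_cmult)
  finally show ?thesis .
qed

lemma measure_cball_plane: "r \<ge> 0 \<Longrightarrow> measure lborel (cball (c :: plane) r) = pi * r\<^sup>2"
  by (simp add: content_cball unit_ball_vol_2)

lemma measure_ball_plane: "r \<ge> 0 \<Longrightarrow> measure lborel (ball (c :: plane) r) = pi * r\<^sup>2"
  by (simp add: circle_area)

text \<open>Layer-cake: the Gaussian is a mixture of indicators of disks, with exponential weights.\<close>

lemma nn_integral_gaussian_plane:
  assumes "l > 0"
  shows "(\<integral>\<^sup>+w. ennreal (exp (- (l * (pi * (norm (w :: plane))\<^sup>2)))) \<partial>lborel) = ennreal (1 / l)"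
proof -
  define k where "k = l * pi"
  have k: "k > 0" using assms by (simp add: k_def)
  have layer: "(\<integral>\<^sup>+t. indicator {(norm w)\<^sup>2..} t * ennreal (k * exp (- k * t)) \<partial>lborel) = ennreal (exp (- (k * (norm w)\<^sup>2)))"
    for w :: plane
  proof -
    have lim: "((\<lambda>t. - exp (- k * t)) \<longlongrightarrow> - 0) at_top"
      using k by (intro tendsto_minus filterlim_compose[OF exp_at_bot]
        filterlim_tendsto_neg_mult_at_bot[OF tendsto_const] filterlim_ident) auto
    have "(\<integral>\<^sup>+t. ennreal (k * exp (- k * t)) * indicator {(norm w)\<^sup>2..} t \<partial>lborel) = ennreal (0 - (- exp (- k * (norm w)\<^sup>2)))"
      using k lim by (intro nn_integral_FTC_atLeast) (auto intro!: derivative_eq_intros)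
    then show ?thesis by (simp add: mult.commute)
  qed
  have [measurable]: "(\<lambda>(w, t). indicator {(norm (w :: plane))\<^sup>2..} t :: ennreal) \<in> borel_measurable (lborel \<Otimes>\<^sub>M lborel)"
    unfolding indicator_def split_beta' atLeast_iff by measurable
  have "(\<integral>\<^sup>+w. ennreal (exp (- (l * (pi * (norm (w :: plane))\<^sup>2)))) \<partial>lborel) =
      (\<integral>\<^sup>+w. \<integral>\<^sup>+t. indicator {(norm (w :: plane))\<^sup>2..} t * ennreal (k * exp (- k * t)) \<partial>lborel \<partial>lborel)"
    unfolding layer by (simp add: k_def mult.assoc)
  also have "\<dots> = (\<integral>\<^sup>+t. \<integral>\<^sup>+w. indicator {(norm (w :: plane))\<^sup>2..} t * ennreal (k * exp (- k * t)) \<partial>lborel \<partial>lborel)"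
    by (rule lborel_pair.Fubini'[symmetric]) measurable
  \<comment> \<open>The disk at level \<open>t\<close> has area \<open>pi * t\<close>, so what
    remains is \<open>pi\<close> times the mean \<open>1 / k\<close> of the exponential law of rate
    \<open>k = l * pi\<close>.\<close>
  also have "\<dots> = (\<integral>\<^sup>+t. ennreal pi * ennreal (erlang_density 0 k t * t ^ 1) \<partial>lborel)"
  proof (rule nn_integral_cong)
    fix t :: real
    have *: "(\<integral>\<^sup>+w. indicator {(norm (w :: plane))\<^sup>2..} t * ennreal (k * exp (- k * t)) \<partial>lborel) =
        emeasure lborel {w :: plane. (norm w)\<^sup>2 \<le> t} * ennreal (k * exp (- k * t))"
    proof -
      have "(\<integral>\<^sup>+w. indicator {(norm (w :: plane))\<^sup>2..} t * ennreal (k * exp (- k * t)) \<partial>lborel) =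
          (\<integral>\<^sup>+w. indicator {w :: plane. (norm w)\<^sup>2 \<le> t} w * ennreal (k * exp (- k * t)) \<partial>lborel)"
        by (intro nn_integral_cong) (simp add: indicator_def)
      also have "\<dots> = (\<integral>\<^sup>+w. indicator {w :: plane. (norm w)\<^sup>2 \<le> t} w \<partial>lborel) * ennreal (k * exp (- k * t))"
        by (rule nn_integral_multc) measurable
      also have "(\<integral>\<^sup>+w. indicator {w :: plane. (norm w)\<^sup>2 \<le> t} w \<partial>lborel) = emeasure lborel {w :: plane. (norm w)\<^sup>2 \<le> t}"
        by (rule nn_integral_indicator) measurable
      finally show ?thesis .
    qed
    show "(\<integral>\<^sup>+w. indicator {(norm (w :: plane))\<^sup>2..} t * ennreal (k * exp (- k * t)) \<partial>lborel) =
        ennreal pi * ennreal (erlang_density 0 k t * t ^ 1)"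
    proof (cases "t < 0")
      case True
      then have "{w :: plane. (norm w)\<^sup>2 \<le> t} = {}"
        by (auto simp: not_le intro: less_le_trans)
      then show ?thesis unfolding * using True by (simp add: erlang_density_def)
    next
      case False
      have "(norm w)\<^sup>2 \<le> t \<longleftrightarrow> norm w \<le> sqrt t" for w :: plane
        using real_sqrt_le_iff[of "(norm w)\<^sup>2" t] by simp
      then have "{w :: plane. (norm w)\<^sup>2 \<le> t} = cball 0 (sqrt t)"
        by (simp only: set_eq_iff mem_Collect_eq mem_cball dist_0_norm) blast
      then have "emeasure lborel {w :: plane. (norm w)\<^sup>2 \<le> t} = ennreal (pi * t)"
        using False by (simp add: emeasure_cball unit_ball_vol_2)
      then show ?thesis unfolding * using False k
        by (simp add: erlang_density_def ennreal_mult'[symmetric] mult_ac)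
    qed
  qed
  also have "\<dots> = ennreal pi * ennreal (1 / k)"
    using k by (subst nn_integral_cmult, simp, subst nn_integral_erlang_ith_moment) auto
  also have "\<dots> = ennreal (1 / l)"
    using assms by (simp add: k_def ennreal_mult'[symmetric])
  finally show ?thesis .
qed

context angle
begin

lemma norm_one_minus_q: "(cmod (1 - q))\<^sup>2 = 4 * (sin (\<theta> / 2))\<^sup>2"
proof -
  have "(cmod (1 - q))\<^sup>2 = 2 - 2 * cos \<theta>"
    by (simp add: cmod_power2 power2_diff sin_squared_eq)
  also have "cos \<theta> = 1 - 2 * (sin (\<theta> / 2))\<^sup>2"
    using cos_double_sin[of "\<theta> / 2"] by simp
  finally show ?thesis by simp
qed

text \<open>Swapping the roles of the two points of a pair amounts to \<open>w \<mapsto> -w\<close>, so requiring the first point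
  to have the smaller abscissa halves the Gaussian integral.\<close>

lemma nn_integral_half_gaussian:
  assumes "l > 0"
  shows "(\<integral>\<^sup>+w. (if w $ 1 < cmult q w $ 1 then ennreal (exp (- (l * (pi * (norm w)\<^sup>2)))) else 0) \<partial>lborel) =
    ennreal (1 / (2 * l))"
proof -
  let ?g = "\<lambda>w :: plane. ennreal (exp (- (l * (pi * (norm w)\<^sup>2))))"
  let ?h = "\<lambda>w :: plane. if w $ 1 < cmult q w $ 1 then ?g w else 0"
  let ?h' = "\<lambda>w :: plane. if w $ 1 > cmult q w $ 1 then ?g w else 0"
  have neg: "cmult (- 1) w = - w" for w
    by (simp add: vec_eq_iff forall_2 cmult_def)
  have cneg: "cmult q (- w) = - cmult q w" for w
    by (simp add: vec_eq_iff forall_2 cmult_def)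
  have "integral\<^sup>N lborel ?h = ennreal ((cmod (- 1))\<^sup>2) * (\<integral>\<^sup>+w. ?h (cmult (- 1) w + 0) \<partial>lborel)"
    by (rule nn_integral_cmult_affine) auto
  also have "\<dots> = integral\<^sup>N lborel ?h'"
    by (auto simp: neg cneg intro!: nn_integral_cong)
  finally have eq: "integral\<^sup>N lborel ?h = integral\<^sup>N lborel ?h'" .
  \<comment> \<open>The first coordinate of \<open>w - cmult q w\<close> is the inner product of
    \<open>w\<close> with this vector, so ties occur on a line only.\<close>
  let ?a = "vector [1 - Re q, Im q] :: plane"
  have "?a \<noteq> 0" using q_neq_1 by (auto simp: vec_eq_iff forall_2 complex_eq_iff)
  then have "negligible {w. ?a \<bullet> w = 0}" by (intro negligible_hyperplane) auto
  moreover have "{w. w $ 1 = cmult q w $ 1} = {w. ?a \<bullet> w = 0}"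
    by (auto simp: cmult_def inner_vec_def sum_2 algebra_simps)
  ultimately have "negligible {w. w $ 1 = cmult q w $ 1}" by simp
  moreover have "{w. w $ 1 = cmult q w $ 1} \<in> sets lborel" by measurable
  ultimately have "{w. w $ 1 = cmult q w $ 1} \<in> null_sets lborel"
    by (simp add: negligible_iff_null_sets null_sets_completion_iff)
  then have ae: "AE w in lborel. w $ 1 \<noteq> cmult q w $ 1" by (rule AE_I') auto
  have "integral\<^sup>N lborel ?h + integral\<^sup>N lborel ?h' = (\<integral>\<^sup>+w. ?h w + ?h' w \<partial>lborel)"
    by (rule nn_integral_add[symmetric]) auto
  also have "\<dots> = integral\<^sup>N lborel ?g"
    using ae by (intro nn_integral_cong_AE) (auto elim!: eventually_mono)
  also have "\<dots> = ennreal (1 / l)" by (rule nn_integral_gaussian_plane[OF assms])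
  finally have sum: "integral\<^sup>N lborel ?h + integral\<^sup>N lborel ?h = ennreal (1 / l)" using eq by simp
  show ?thesis
  proof (cases "integral\<^sup>N lborel ?h" rule: ennreal_cases)
    case (real r)
    then have "r + r = 1 / l" using sum assms by (simp add: ennreal_plus[symmetric] del: ennreal_plus)
    then have "r = 1 / (2 * l)" by (simp add: field_simps)
    then show ?thesis using real by simp
  next
    case top
    then show ?thesis using sum by simp
  qed
qed

text \<open>For fixed \<open>x\<close> the substitution is \<open>y = z + q (x - z)\<close>. Then
  both the order condition and the weight depend on \<open>w = x - z\<close> alone, so integrating
  over \<open>x\<close> first gives the same value for every \<open>z\<close> in the unit
  square.\<close>

lemma nn_integral_pair_weight:
  assumes "l > 0"
  shows "(\<integral>\<^sup>+x. \<integral>\<^sup>+y. (if x $ 1 < y $ 1 \<and> apex \<theta> x y \<in> cbox 0 1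
      then ennreal (exp (- (l * (pi * (dist (apex \<theta> x y) x)\<^sup>2)))) else 0) \<partial>lborel \<partial>lborel) =
    ennreal (2 * (sin (\<theta> / 2))\<^sup>2 / l)"
proof -
  let ?Q = "cbox 0 1 :: plane set"
  define h where "h w = (if w $ 1 < cmult q w $ 1 then ennreal (exp (- (l * (pi * (norm w)\<^sup>2)))) else 0)" for w
  have [measurable]: "h \<in> borel_measurable borel" unfolding h_def by measurable
  let ?J = "ennreal ((cmod (1 - q))\<^sup>2)"
  have inner: "(\<integral>\<^sup>+y. (if x $ 1 < y $ 1 \<and> apex \<theta> x y \<in> ?Q
      then ennreal (exp (- (l * (pi * (dist (apex \<theta> x y) x)\<^sup>2)))) else 0) \<partial>lborel) =
      ?J * (\<integral>\<^sup>+z. indicator ?Q z * h (x - z) \<partial>lborel)" for x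
  proof -
    have y: "cmult (1 - q) z + cmult q x = z + cmult q (x - z)" for z
      by (simp add: cmult_diff_left cmult_1 cmult_diff algebra_simps)
    have a: "apex \<theta> x (z + cmult q (x - z)) = z" for z
      using apex_iff[of z x "z + cmult q (x - z)"] by simp
    have "(\<integral>\<^sup>+y. (if x $ 1 < y $ 1 \<and> apex \<theta> x y \<in> ?Q
      then ennreal (exp (- (l * (pi * (dist (apex \<theta> x y) x)\<^sup>2)))) else 0) \<partial>lborel) =
      ?J * (\<integral>\<^sup>+z. (if x $ 1 < (z + cmult q (x - z)) $ 1 \<and> z \<in> ?Q
        then ennreal (exp (- (l * (pi * (dist z x)\<^sup>2)))) else 0) \<partial>lborel)"
      by (subst nn_integral_cmult_affine[OF _ one_minus_q, where b="cmult q x"])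
         (simp_all add: y a del: vector_add_component cong: if_cong)
    also have "(\<integral>\<^sup>+z. (if x $ 1 < (z + cmult q (x - z)) $ 1 \<and> z \<in> ?Q
        then ennreal (exp (- (l * (pi * (dist z x)\<^sup>2)))) else 0) \<partial>lborel) =
        (\<integral>\<^sup>+z. indicator ?Q z * h (x - z) \<partial>lborel)"
      by (intro nn_integral_cong) (auto simp: h_def dist_norm norm_minus_commute split: split_indicator)
    finally show ?thesis .
  qed
  have [measurable]: "(\<lambda>(x, z). indicator ?Q z * h (x - z)) \<in> borel_measurable (lborel \<Otimes>\<^sub>M lborel)"
    by measurable
  have "(\<integral>\<^sup>+x. ?J * (\<integral>\<^sup>+z. indicator ?Q z * h (x - z) \<partial>lborel) \<partial>lborel) =
      ?J * (\<integral>\<^sup>+x. \<integral>\<^sup>+z. indicator ?Q z * h (x - z) \<partial>lborel \<partial>lborel)"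
    by (rule nn_integral_cmult) measurable
  also have "(\<integral>\<^sup>+x. \<integral>\<^sup>+z. indicator ?Q z * h (x - z) \<partial>lborel \<partial>lborel) =
      (\<integral>\<^sup>+z. \<integral>\<^sup>+x. indicator ?Q z * h (x - z) \<partial>lborel \<partial>lborel)"
    by (rule lborel_pair.Fubini'[symmetric]) measurable
  also have "\<dots> = (\<integral>\<^sup>+z. ennreal (1 / (2 * l)) * indicator ?Q z \<partial>lborel)"
  proof (rule nn_integral_cong)
    fix z
    have "(\<integral>\<^sup>+x. indicator ?Q z * h (x - z) \<partial>lborel) = indicator ?Q z * (\<integral>\<^sup>+x. h (x + - z) \<partial>lborel)"
      by (simp add: nn_integral_cmult)
    also have "(\<integral>\<^sup>+x. h (x + - z) \<partial>lborel) = ennreal (1 / (2 * l))"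
      using nn_integral_half_gaussian[OF assms] by (subst nn_integral_lborel_translate) (simp_all flip: h_def)
    finally show "(\<integral>\<^sup>+x. indicator ?Q z * h (x - z) \<partial>lborel) = ennreal (1 / (2 * l)) * indicator ?Q z"
      by (simp add: mult.commute)
  qed
  also have "\<dots> = ennreal (1 / (2 * l)) * emeasure lborel ?Q"
    by (simp add: nn_integral_cmult)
  also have "emeasure lborel ?Q = 1"
  proof -
    have "(1 :: plane) \<bullet> b = 1" if "b \<in> Basis" for b
      using that by (auto simp: Basis_vec_def inner_axis)
    then show ?thesis by (subst emeasure_lborel_cbox) auto
  qed
  finally show ?thesis
    unfolding inner norm_one_minus_q using assms by (simp add: ennreal_mult'[symmetric])
qed

end

section \<open>The intensity\<close>

context poisson_law
begin

lemma pred_nearest_P: "Measurable.pred P (\<lambda>\<phi>. nearest \<phi> X p)"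
  by (rule measurable_nearest[OF id_measurable_P]) auto

text \<open>This is what makes the facets bounded: a Poisson configuration meets the large disks centred far out on
  the bisector.\<close>

lemma AE_not_nearest:
  assumes lim: "filterlim (\<lambda>n. dist (p n) X) at_top sequentially"
  shows "AE \<phi> in P. \<exists>n. \<not> nearest \<phi> X (p n)"
proof -
  define N where "N = {\<phi> \<in> space P. \<forall>n. nearest \<phi> X (p n)}"
  have "N \<in> sets P" unfolding N_def using pred_nearest_P by measurable
  then have N: "N \<in> sets configurations" by simp
  have bound: "prob N \<le> exp (- (l * (pi * (dist (p n) X)\<^sup>2)))" for n
  proof -
    have "prob N \<le> prob (void_event (ball (p n) (dist (p n) X)))"
    proof (rule finite_measure_mono)
      show "N \<subseteq> void_event (ball (p n) (dist (p n) X))"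
        by (auto simp: N_def void_event_def nearest_def not_less[symmetric])
    qed (simp add: void_event_sets)
    then show ?thesis by (simp add: prob_void measure_ball_plane)
  qed
  have "((\<lambda>n. exp (- (l * (pi * (dist (p n) X)\<^sup>2)))) \<longlongrightarrow> 0) sequentially"
  proof (rule filterlim_compose[OF exp_at_bot])
    have "filterlim (\<lambda>n. (l * pi) * (dist (p n) X)\<^sup>2) at_top sequentially"
      using l_pos by (intro filterlim_tendsto_pos_mult_at_top[OF tendsto_const] filterlim_pow_at_top lim) auto
    then show "filterlim (\<lambda>n. - (l * (pi * (dist (p n) X)\<^sup>2))) at_bot sequentially"
      by (simp add: filterlim_uminus_at_bot mult.assoc)
  qed
  then have "prob N \<le> 0"
    by (rule tendsto_lowerbound) (auto intro: always_eventually bound)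
  then have "N \<in> null_sets P"
    by (intro null_setsI) (auto simp: emeasure_eq_measure measure_le_0_iff N)
  then show ?thesis by (rule AE_I') (auto simp: N_def)
qed

end

text \<open>The coefficients \<open>c n\<close> may be \<open>n\<close> or \<open>- n\<close>, which
  treats both rays of a bisector.\<close>

lemma filterlim_dist_line:
  fixes u :: "'a::real_normed_vector"
  assumes "u \<noteq> 0" "\<And>n. \<bar>c n\<bar> = real n"
  shows "filterlim (\<lambda>n. dist (Z + c n *\<^sub>R u) X) at_top sequentially"
proof (rule filterlim_at_top_mono)
  show "filterlim (\<lambda>n. - norm (X - Z) + real n * norm u) at_top sequentially"
    using assms(1) by (intro filterlim_tendsto_add_at_top[OF tendsto_const]
      filterlim_at_top_mult_tendsto_pos[OF tendsto_const] filterlim_real_sequentially) auto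
  have "real n * norm u \<le> dist (Z + c n *\<^sub>R u) X + norm (X - Z)" for n
    using norm_triangle_ineq[of "Z + c n *\<^sub>R u - X" "X - Z"] assms(2)[of n] by (simp add: dist_norm)
  then show "\<forall>\<^sub>F n in sequentially. - norm (X - Z) + real n * norm u \<le> dist (Z + c n *\<^sub>R u) X"
    by (intro always_eventually allI) (smt (verit))
qed

context angle
begin

text \<open>Local finiteness leaves a gap between the empty closed disk and the other points. Within
  it the apex can slide along the bisector with \<open>X\<close> still nearest, which gives the
  facet positive length.\<close>

lemma facet_atI:
  assumes "\<psi> \<in> locally_finite_sets" "X \<noteq> Y"
    and void: "\<psi> \<inter> cball (apex \<theta> X Y) (dist (apex \<theta> X Y) X) = {}"
    and esc: "\<exists>n. \<not> nearest \<psi> X (bisector_point \<theta> X Y (real n))"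
      "\<exists>n. \<not> nearest \<psi> X (bisector_point \<theta> X Y (- real n))"
    and \<phi>: "\<psi> \<subseteq> \<phi>" "\<phi> \<subseteq> insert X (insert Y \<psi>)"
  shows "facet_at \<theta> X Y \<phi>"
proof -
  let ?Z = "apex \<theta> X Y" and ?b = "bisector_point \<theta> X Y"
  have bis: "dist (?b s) X = dist (?b s) Y" for s
    unfolding bisector_point_def using bisector_iff[OF dist_apex assms(2)] by blast
  \<comment> \<open>Restoring \<open>X\<close> and \<open>Y\<close> changes nothing on the bisector,
    where they are equally far away.\<close>
  have near: "nearest \<phi> X (?b s)" if "nearest \<psi> X (?b s)" for s
    using that bis[of s] \<phi>(2) unfolding nearest_def by auto
  have Z: "?b 0 = ?Z" by (simp add: bisector_point_def)
  let ?r = "dist ?Z X"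
  have gt: "dist ?Z W > ?r" if "W \<in> \<psi>" for W using void that by (auto simp: not_le[symmetric])
  define F where "F = \<psi> \<inter> cball ?Z (?r + 1)"
  have "finite F" unfolding F_def using assms(1) by (rule locally_finiteD) simp
  \<comment> \<open>The width of the gap. Points outside \<open>F\<close> are farther than
    \<open>?r + 1\<close>, and inserting this value keeps the minimum defined for empty
    \<open>F\<close>.\<close>
  define e where "e = Min (insert (?r + 1) (dist ?Z ` F)) - ?r"
  have e: "e > 0" using \<open>finite F\<close> gt by (auto simp: e_def F_def)
  have far: "?r + e \<le> dist ?Z W" if "W \<in> \<psi>" for W
  proof (cases "W \<in> F")
    case True
    then have "Min (insert (?r + 1) (dist ?Z ` F)) \<le> dist ?Z W"
      using \<open>finite F\<close> by (intro Min_le) auto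
    then show ?thesis by (simp add: e_def)
  next
    case False
    have "Min (insert (?r + 1) (dist ?Z ` F)) \<le> ?r + 1"
      using \<open>finite F\<close> by (intro Min_le) auto
    then show ?thesis using False that by (auto simp: e_def F_def)
  qed
  have nZ: "nearest \<psi> X (?b 0)" using gt unfolding Z nearest_def by (auto intro: less_imp_le)
  let ?u = "cmult \<i> (Y - X)"
  have "?u \<noteq> 0" using assms(2) by simp
  then have "e / (2 * norm ?u) > 0" using e by simp
  then obtain n where n: "1 / real (Suc n) < e / (2 * norm ?u)"
    using reals_Archimedean by (metis inverse_eq_divide)
  \<comment> \<open>A move of at most \<open>e / 2\<close> adds at most that to the distance from
    \<open>X\<close> and takes at most that from any other, so the gap \<open>e\<close> absorbs
    both.\<close>
  have step: "dist ?Z (?b (1 / real (Suc n))) \<le> e / 2"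
  proof -
    have "dist ?Z (?b (1 / real (Suc n))) = 1 / real (Suc n) * norm ?u"
      by (simp add: bisector_point_def dist_norm)
    also have "\<dots> \<le> e / (2 * norm ?u) * norm ?u" using n by (intro mult_right_mono) auto
    also have "\<dots> = e / 2" using \<open>?u \<noteq> 0\<close> by simp
    finally show ?thesis .
  qed
  have "nearest \<psi> X (?b (1 / real (Suc n)))"
    unfolding nearest_def
  proof
    fix W assume "W \<in> \<psi>"
    from far[OF this] step show "dist (?b (1 / real (Suc n))) X \<le> dist (?b (1 / real (Suc n))) W"
      using dist_triangle[of "?b (1 / real (Suc n))" X ?Z] dist_triangle[of ?Z W "?b (1 / real (Suc n))"]
      by (simp add: dist_commute)
  qed
  then have "nearest \<phi> X (?b (1 / real (Suc n)))" by (rule near)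
  moreover have "nearest \<phi> X ?Z" using near[OF nZ] Z by simp
  moreover have "\<not> nearest \<phi> X p" if "\<not> nearest \<psi> X p" for p
    using that \<phi>(1) unfolding nearest_def by blast
  ultimately show ?thesis unfolding facet_at_def using esc by blast
qed

end

section \<open>Counting apices in the unit square\<close>

locale poisson_angle = poisson_law P l + angle \<theta> for P l \<theta>
begin

text \<open>Each removal deletes one point, so the iterated sum counts ordered pairs of distinct
  points. Their number may be infinite, hence counting measure instead of
  \<open>card\<close>.\<close>

lemma palm_sum2_predicate:
  "palm_sum (\<lambda>(x, \<psi>). palm_sum (\<lambda>(y, \<eta>). if G x y \<eta> then 1 else 0) \<psi>) \<phi> =
    emeasure (count_space UNIV) {(x, y). x \<in> \<phi> \<and> y \<in> \<phi> \<and> y \<noteq> x \<and> G x y (\<phi> - {x} - {y})}"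
proof -
  let ?T = "{(x, y). x \<in> \<phi> \<and> y \<in> \<phi> \<and> y \<noteq> x \<and> G x y (\<phi> - {x} - {y})}"
  have "palm_sum (\<lambda>(x, \<psi>). palm_sum (\<lambda>(y, \<eta>). if G x y \<eta> then 1 else 0) \<psi>) \<phi> =
      (\<integral>\<^sup>+x. \<integral>\<^sup>+y. indicator ?T (x, y) \<partial>count_space UNIV \<partial>count_space UNIV)"
    unfolding palm_sum_def
    by (subst (1 2) nn_integral_count_space_indicator, simp, simp)
       (auto intro!: nn_integral_cong simp: nn_integral_multc[symmetric] split: split_indicator)
  also have "\<dots> = (\<integral>\<^sup>+p. indicator ?T p \<partial>count_space UNIV)"
    by (rule nn_integral_fst_count_space)
  also have "\<dots> = emeasure (count_space UNIV) ?T" by (rule nn_integral_indicator) simp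
  finally show ?thesis .
qed

abbreviation open_pair :: "plane \<Rightarrow> plane \<Rightarrow> plane set \<Rightarrow> bool" where
  "open_pair x y \<psi> \<equiv> x $ 1 < y $ 1 \<and> apex \<theta> x y \<in> cbox 0 1 \<and> nearest \<psi> x (apex \<theta> x y)"

abbreviation closed_pair :: "plane \<Rightarrow> plane \<Rightarrow> plane set \<Rightarrow> bool" where
  "closed_pair x y \<psi> \<equiv> x $ 1 < y $ 1 \<and> apex \<theta> x y \<in> cbox 0 1 \<and>
     (\<forall>W\<in>\<psi>. dist (apex \<theta> x y) x < dist (apex \<theta> x y) W) \<and>
     (\<exists>n. \<not> nearest \<psi> x (bisector_point \<theta> x y (real n))) \<and>
     (\<exists>n. \<not> nearest \<psi> x (bisector_point \<theta> x y (- real n)))"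

text \<open>Keeping only the nearest-point condition enlarges the set of pairs, and pairs sharing an
  apex are counted repeatedly on the right.\<close>

lemma card_angle_points_le:
  assumes "\<phi> \<in> locally_finite_sets"
  shows "of_nat (card (angle_points \<theta> \<phi> \<inter> cbox 0 1)) \<le>
    palm_sum (\<lambda>(x, \<psi>). palm_sum (\<lambda>(y, \<eta>). if open_pair x y \<eta> then 1 else 0) \<psi>) \<phi>"
proof -
  let ?T = "{(x, y). x \<in> \<phi> \<and> y \<in> \<phi> \<and> y \<noteq> x \<and> open_pair x y (\<phi> - {x} - {y})}"
  have sub: "angle_points \<theta> \<phi> \<inter> cbox 0 1 \<subseteq> (\<lambda>(x, y). apex \<theta> x y) ` ?T"
  proof
    fix z assume "z \<in> angle_points \<theta> \<phi> \<inter> cbox 0 1"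
    then obtain x y where *: "z = apex \<theta> x y" "x \<in> \<phi>" "y \<in> \<phi>" "x $ 1 < y $ 1" "nearest \<phi> x z" "z \<in> cbox 0 1"
      unfolding angle_points_eq facet_at_def by blast
    then have "(x, y) \<in> ?T" by (auto simp: nearest_def)
    with *(1) show "z \<in> (\<lambda>(x, y). apex \<theta> x y) ` ?T" by (metis (no_types, lifting) case_prod_conv image_eqI)
  qed
  show ?thesis
  proof (cases "finite ?T")
    case True
    have "card (angle_points \<theta> \<phi> \<inter> cbox 0 1) \<le> card ((\<lambda>(x, y). apex \<theta> x y) ` ?T)"
      using True sub by (intro card_mono) auto
    also have "\<dots> \<le> card ?T" using True by (rule card_image_le)
    finally show ?thesis unfolding palm_sum2_predicate using True by simp
  next
    case False
    then show ?thesis unfolding palm_sum2_predicate by simp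
  qed
qed

text \<open>The apex is injective here because the pair can be read off as the set of points of the configuration
  nearest to it.\<close>

lemma card_angle_points_ge:
  assumes \<phi>: "\<phi> \<in> locally_finite_sets"
  shows "palm_sum (\<lambda>(x, \<psi>). palm_sum (\<lambda>(y, \<eta>). if closed_pair x y \<eta> then 1 else 0) \<psi>) \<phi> \<le>
    of_nat (card (angle_points \<theta> \<phi> \<inter> cbox 0 1))"
proof -
  let ?T = "{(x, y). x \<in> \<phi> \<and> y \<in> \<phi> \<and> y \<noteq> x \<and> closed_pair x y (\<phi> - {x} - {y})}"
  let ?f = "\<lambda>(x, y). apex \<theta> x y"
  have inj: "inj_on ?f ?T"
  proof (rule inj_onI)
    fix p p' assume T: "p \<in> ?T" "p' \<in> ?T" and "?f p = ?f p'"
    obtain x y x' y' where p: "p = (x, y)" "p' = (x', y')" by (cases p, cases p') blast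
    have eq: "apex \<theta> x y = apex \<theta> x' y'" using \<open>?f p = ?f p'\<close> by (simp add: p)
    have a: "x \<in> \<phi>" "y \<in> \<phi>" "x' \<in> \<phi>" "y' \<in> \<phi>" "x $ 1 < y $ 1" "x' $ 1 < y' $ 1"
      and c: "\<forall>W\<in>\<phi> - {x} - {y}. dist (apex \<theta> x y) x < dist (apex \<theta> x y) W"
      and c': "\<forall>W\<in>\<phi> - {x'} - {y'}. dist (apex \<theta> x' y') x' < dist (apex \<theta> x' y') W"
      using T unfolding p by blast+
    define z r r' where "z = apex \<theta> x y" and "r = dist z x" and "r' = dist z x'"
    have d: "dist z x = r" "dist z y = r" "dist z x' = r'" "dist z y' = r'"
      using dist_apex[of x y] dist_apex[of x' y'] eq by (simp_all add: z_def r_def r'_def)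
    have c: "W \<in> {x, y} \<or> r < dist z W" if "W \<in> \<phi>" for W
      using c that by (auto simp: r_def z_def)
    have c': "W \<in> {x', y'} \<or> r' < dist z W" if "W \<in> \<phi>" for W
      using c' that eq by (auto simp: r'_def z_def)
    \<comment> \<open>A point of one pair strictly closer to the common apex than the other pair
      would violate the emptiness of the latter's disk. Hence the radii agree, the pairs coincide as
      sets, and the abscissas fix their order.\<close>
    have "\<not> r' < r" using c[OF a(3)] d by auto
    moreover have "\<not> r < r'" using c'[OF a(1)] d by auto
    ultimately have "x \<in> {x', y'}" "y \<in> {x', y'}" "x' \<in> {x, y}"
      using c[OF a(3)] c'[OF a(1)] c'[OF a(2)] d by auto
    then show "p = p'" using a(5,6) by (auto simp: p)
  qed
  have sub: "?f ` ?T \<subseteq> angle_points \<theta> \<phi> \<inter> cbox 0 1"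
  proof
    fix z assume "z \<in> ?f ` ?T"
    then obtain p where p: "p \<in> ?T" "z = ?f p" by blast
    obtain x y where xy: "p = (x, y)" by (cases p)
    have z: "z = apex \<theta> x y" and T: "(x, y) \<in> ?T" using p by (simp_all add: xy)
    from T have a: "x \<in> \<phi>" "y \<in> \<phi>" "y \<noteq> x" "x $ 1 < y $ 1" "apex \<theta> x y \<in> cbox 0 1"
      and b: "\<forall>W\<in>\<phi> - {x} - {y}. dist (apex \<theta> x y) x < dist (apex \<theta> x y) W"
      and c: "\<exists>n. \<not> nearest (\<phi> - {x} - {y}) x (bisector_point \<theta> x y (real n))"
        "\<exists>n. \<not> nearest (\<phi> - {x} - {y}) x (bisector_point \<theta> x y (- real n))"
      by blast+
    have "facet_at \<theta> x y \<phi>"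
    proof (rule facet_atI[OF _ _ _ c])
      show "\<phi> - {x} - {y} \<in> locally_finite_sets" using \<phi> by (rule locally_finite_subset) auto
      show "(\<phi> - {x} - {y}) \<inter> cball (apex \<theta> x y) (dist (apex \<theta> x y) x) = {}"
        using b by (auto simp: not_le[symmetric])
    qed (use a in auto)
    then show "z \<in> angle_points \<theta> \<phi> \<inter> cbox 0 1"
      using a unfolding angle_points_eq z by auto
  qed
  have fin: "finite (angle_points \<theta> \<phi> \<inter> cbox 0 1)"
    by (rule locally_finiteD[OF angle_points_locally_finite[OF \<phi>]]) simp
  then have "finite ?T" using inj sub by (meson finite_imageD finite_subset)
  moreover have "card ?T \<le> card (angle_points \<theta> \<phi> \<inter> cbox 0 1)"
    by (rule card_inj_on_le[OF inj sub fin])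
  ultimately show ?thesis unfolding palm_sum2_predicate by simp
qed

text \<open>Common to both bounds: the mean depends on \<open>G\<close> only through its
  probabilities for fixed pairs. The diagonal is treated apart because the bisector has no direction
  there.\<close>

lemma nn_integral_pairs:
  assumes G: "Measurable.pred (borel \<Otimes>\<^sub>M (borel \<Otimes>\<^sub>M P)) (\<lambda>(x, y, \<phi>). G x y \<phi>)"
    and w: "\<And>x y. x \<noteq> y \<Longrightarrow> prob {\<phi> \<in> space P. G x y \<phi>} =
      (if x $ 1 < y $ 1 \<and> apex \<theta> x y \<in> cbox 0 1 then exp (- (l * (pi * (dist (apex \<theta> x y) x)\<^sup>2))) else 0)"
    and irrefl: "\<And>x \<phi>. \<not> G x x \<phi>"
  shows "(\<integral>\<^sup>+\<phi>. palm_sum (\<lambda>(x, \<psi>). palm_sum (\<lambda>(y, \<eta>). if G x y \<eta> then 1 else 0) \<psi>) \<phi> \<partial>P) =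
    ennreal (2 * l * (sin (\<theta> / 2))\<^sup>2)"
proof -
  let ?g = "\<lambda>(x, y, \<phi>). if G x y \<phi> then 1 else 0 :: ennreal"
  have g: "?g \<in> borel_measurable (borel \<Otimes>\<^sub>M (borel \<Otimes>\<^sub>M P))"
    using G by (simp add: split_beta')
  have "(\<integral>\<^sup>+\<phi>. ?g (x, y, \<phi>) \<partial>P) = (if x $ 1 < y $ 1 \<and> apex \<theta> x y \<in> cbox 0 1
      then ennreal (exp (- (l * (pi * (dist (apex \<theta> x y) x)\<^sup>2)))) else 0)" for x y
  proof (cases "x = y")
    case True
    then show ?thesis using irrefl by simp
  next
    case False
    have "{\<phi> \<in> space P. G x y \<phi>} \<in> sets P"
      using measurable_compose[OF _ G, of "\<lambda>\<phi>. (x, y, \<phi>)" P] by (simp add: pred_def)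
    then have "(\<integral>\<^sup>+\<phi>. indicator {\<phi> \<in> space P. G x y \<phi>} \<phi> \<partial>P) = emeasure P {\<phi> \<in> space P. G x y \<phi>}"
      by (rule nn_integral_indicator)
    moreover have "(\<integral>\<^sup>+\<phi>. ?g (x, y, \<phi>) \<partial>P) = (\<integral>\<^sup>+\<phi>. indicator {\<phi> \<in> space P. G x y \<phi>} \<phi> \<partial>P)"
      by (intro nn_integral_cong) (simp add: indicator_def)
    ultimately have "(\<integral>\<^sup>+\<phi>. ?g (x, y, \<phi>) \<partial>P) = emeasure P {\<phi> \<in> space P. G x y \<phi>}" by simp
    then show ?thesis using w[OF False] by (simp add: emeasure_eq_measure)
  qed
  then have "(\<integral>\<^sup>+\<phi>. palm_sum (\<lambda>(x, \<psi>). palm_sum (\<lambda>p. ?g (x, p)) \<psi>) \<phi> \<partial>P) =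
      ennreal l * (ennreal l * ennreal (2 * (sin (\<theta> / 2))\<^sup>2 / l))"
    unfolding nn_integral_palm_sum2[OF g] nn_integral_pair_weight[OF l_pos, symmetric] by simp
  also have "\<dots> = ennreal (2 * l * (sin (\<theta> / 2))\<^sup>2)"
    using l_pos by (simp add: ennreal_mult'[symmetric] field_simps)
  finally show ?thesis by simp
qed

lemma measurable_P_iff: "measurable N P = measurable N configurations"
  by (rule measurable_cong_sets) auto

lemma nn_integral_card_angle_points:
  "(\<integral>\<^sup>+\<phi>. of_nat (card (angle_points \<theta> \<phi> \<inter> cbox 0 1)) \<partial>P) = ennreal (2 * l * (sin (\<theta> / 2))\<^sup>2)"
proof (rule antisym)
  let ?N = "(borel :: plane measure) \<Otimes>\<^sub>M ((borel :: plane measure) \<Otimes>\<^sub>M P)"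
  have [measurable]: "(\<lambda>p. snd (snd p)) \<in> measurable ?N configurations"
    unfolding measurable_P_iff[symmetric] by measurable
  have mn: "Measurable.pred ?N (\<lambda>p. nearest (snd (snd p)) (fst p) (f p))" if "f \<in> borel_measurable ?N" for f
    using that by (intro measurable_nearest) auto
  have nb: "Measurable.pred ?N (\<lambda>p. nearest (snd (snd p)) (fst p) (bisector_point \<theta> (fst p) (fst (snd p)) s))" for s
    unfolding bisector_point_def by (rule mn) measurable
  have na: "Measurable.pred ?N (\<lambda>p. nearest (snd (snd p)) (fst p) (apex \<theta> (fst p) (fst (snd p))))"
    by (rule mn) measurable
  have ns: "Measurable.pred ?N (\<lambda>p. \<forall>W\<in>snd (snd p). dist (apex \<theta> (fst p) (fst (snd p))) (fst p) <
      dist (apex \<theta> (fst p) (fst (snd p))) W)"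
    by (rule pred_all_configuration) measurable
  note [measurable] = nb na ns
  \<comment> \<open>The weak inequality empties the open disk, the strict one below the closed disk.
    Equal areas give equal probabilities.\<close>
  have void: "{\<phi> \<in> space P. nearest \<phi> x z} = void_event (ball z (dist z x))" for x z
    by (auto simp: nearest_def void_event_def not_less[symmetric])
  have void': "{\<phi> \<in> space P. \<forall>W\<in>\<phi>. dist z x < dist z W} = void_event (cball z (dist z x))" for x z
    by (auto simp: void_event_def not_le[symmetric])
  have "(\<integral>\<^sup>+\<phi>. of_nat (card (angle_points \<theta> \<phi> \<inter> cbox 0 1)) \<partial>P) \<le>
      (\<integral>\<^sup>+\<phi>. palm_sum (\<lambda>(x, \<psi>). palm_sum (\<lambda>(y, \<eta>). if open_pair x y \<eta> then 1 else 0) \<psi>) \<phi> \<partial>P)"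
    by (intro nn_integral_mono card_angle_points_le) simp
  also have "\<dots> = ennreal (2 * l * (sin (\<theta> / 2))\<^sup>2)"
  proof (rule nn_integral_pairs)
    show "Measurable.pred ?N (\<lambda>(x, y, \<phi>). open_pair x y \<phi>)"
      unfolding split_beta' by measurable
    fix x y :: plane
    show "prob {\<phi> \<in> space P. open_pair x y \<phi>} =
      (if x $ 1 < y $ 1 \<and> apex \<theta> x y \<in> cbox 0 1 then exp (- (l * (pi * (dist (apex \<theta> x y) x)\<^sup>2))) else 0)"
      using prob_void[of "ball (apex \<theta> x y) (dist (apex \<theta> x y) x)"]
      by (auto simp: void[simplified] measure_ball_plane)
  qed simp
  finally show "(\<integral>\<^sup>+\<phi>. of_nat (card (angle_points \<theta> \<phi> \<inter> cbox 0 1)) \<partial>P) \<le> ennreal (2 * l * (sin (\<theta> / 2))\<^sup>2)" .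
  have closed: "Measurable.pred ?N (\<lambda>(x, y, \<phi>). closed_pair x y \<phi>)"
    unfolding split_beta' by measurable
  have "ennreal (2 * l * (sin (\<theta> / 2))\<^sup>2) =
      (\<integral>\<^sup>+\<phi>. palm_sum (\<lambda>(x, \<psi>). palm_sum (\<lambda>(y, \<eta>). if closed_pair x y \<eta> then 1 else 0) \<psi>) \<phi> \<partial>P)"
  proof (rule nn_integral_pairs[symmetric, OF closed])
    fix x y :: plane assume "x \<noteq> y"
    let ?z = "apex \<theta> x y"
    have u: "cmult \<i> (y - x) \<noteq> 0" using \<open>x \<noteq> y\<close> by simp
    have esc: "AE \<phi> in P. \<exists>n. \<not> nearest \<phi> x (bisector_point \<theta> x y (real n))"
      "AE \<phi> in P. \<exists>n. \<not> nearest \<phi> x (bisector_point \<theta> x y (- real n))"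
      unfolding bisector_point_def by (intro AE_not_nearest filterlim_dist_line[OF u]; simp)+
    have cp: "{\<phi> \<in> space P. closed_pair x y \<phi>} \<in> sets P"
    proof -
      have "(\<lambda>\<phi>. (x, y, \<phi>)) \<in> measurable P ?N" by measurable
      from measurable_compose[OF this closed] show ?thesis by (simp only: prod.case pred_def)
    qed
    show "prob {\<phi> \<in> space P. closed_pair x y \<phi>} =
      (if x $ 1 < y $ 1 \<and> ?z \<in> cbox 0 1 then exp (- (l * (pi * (dist ?z x)\<^sup>2))) else 0)"
    proof (cases "x $ 1 < y $ 1 \<and> ?z \<in> cbox 0 1")
      case True
      have "prob {\<phi> \<in> space P. closed_pair x y \<phi>} = prob (void_event (cball ?z (dist ?z x)))"
      proof (rule finite_measure_eq_AE)
        \<comment> \<open>The escape conditions hold almost surely, so only emptiness of the closed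
          disk affects the probability.\<close>
        show "AE \<phi> in P. \<phi> \<in> {\<phi> \<in> space P. closed_pair x y \<phi>} \<longleftrightarrow> \<phi> \<in> void_event (cball ?z (dist ?z x))"
          using esc by eventually_elim (use True in \<open>simp only: void'[symmetric] mem_Collect_eq, blast\<close>)
        show "{\<phi> \<in> space P. closed_pair x y \<phi>} \<in> sets P" by (rule cp)
        show "void_event (cball ?z (dist ?z x)) \<in> sets P" by (simp add: void_event_sets)
      qed
      then show ?thesis using True by (simp add: prob_void measure_cball_plane)
    next
      case False
      then have "{\<phi> \<in> space P. closed_pair x y \<phi>} = {}" by blast
      with False show ?thesis by (simp only: if_False measure_empty)
    qed
  qed simp
  also have "\<dots> \<le> (\<integral>\<^sup>+\<phi>. of_nat (card (angle_points \<theta> \<phi> \<inter> cbox 0 1)) \<partial>P)"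
    by (intro nn_integral_mono card_angle_points_ge) simp
  finally show "ennreal (2 * l * (sin (\<theta> / 2))\<^sup>2) \<le> (\<integral>\<^sup>+\<phi>. of_nat (card (angle_points \<theta> \<phi> \<inter> cbox 0 1)) \<partial>P)" .
qed

end

section \<open>From the process to its law, and the theorem\<close>

lemma poisson_law_distr:
  assumes "l > 0" and hpp: "homogeneous_poisson_process M l \<Phi>"
  shows "poisson_law (distr M configurations \<Phi>) l"
proof -
  have \<Phi> [measurable]: "\<Phi> \<in> measurable M configurations" and "prob_space M"
    using hpp by (auto simp: homogeneous_poisson_process_def point_process_def)
  interpret prob_space M by fact
  interpret D: prob_space "distr M configurations \<Phi>" by (rule prob_space_distr) simp
  have lf: "\<Phi> \<omega> \<in> locally_finite_sets" if "\<omega> \<in> space M" for \<omega>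
    using measurable_space[OF \<Phi> that] by (simp add: space_configurations)
  show ?thesis
  proof unfold_locales
    fix A B :: "plane set" and n
    assume AB: "A \<in> sets borel" "bounded A" "B \<in> sets borel" "bounded B" "A \<inter> B = {}"
    \<comment> \<open>Independence is applied to the indices 0 and 1, with counts \<open>n\<close>
      on \<open>A\<close> and 0 on \<open>B\<close>. A zero count means a void, as the intersection
      with a bounded set is finite.\<close>
    define C where "C = (\<lambda>i::nat. if i = 0 then A else B)"
    define k :: "nat \<Rightarrow> nat" where "k = (\<lambda>i. if i = 0 then n else 0)"
    define E where "E i = {\<omega> \<in> space M. card (\<Phi> \<omega> \<inter> C i) = k i}" for i
    have "indep_vars (\<lambda>_. count_space UNIV) (\<lambda>i \<omega>. card (\<Phi> \<omega> \<inter> C i)) {..<2}"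
      using hpp AB unfolding homogeneous_poisson_process_def
      by (elim conjE allE[of _ 2] allE[of _ C] impE) (auto simp: C_def disjoint_family_on_def)
    then have ind: "indep_sets (\<lambda>i. {(\<lambda>\<omega>. card (\<Phi> \<omega> \<inter> C i)) -` D \<inter> space M | D. D \<in> sets (count_space UNIV)}) {..<2}"
      by (simp add: indep_vars_def2)
    have "E i = (\<lambda>\<omega>. card (\<Phi> \<omega> \<inter> C i)) -` {k i} \<inter> space M" for i
      by (auto simp: E_def)
    then have "prob (\<Inter>i\<in>{..<2}. E i) = (\<Prod>i\<in>{..<2}. prob (E i))"
      by (intro indep_setsD[OF ind]) (auto simp: lessThan_empty_iff)
    then have "prob (E 0 \<inter> E 1) = prob (E 0) * prob (E 1)"
      by (simp add: numeral_2_eq_2 lessThan_Suc Int_commute mult.commute)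
    moreover have "prob (E i) = (l * measure lborel (C i)) ^ k i / fact (k i) * exp (- (l * measure lborel (C i)))" for i
      using hpp AB by (auto simp: homogeneous_poisson_process_def E_def C_def)
    ultimately have "prob (E 0 \<inter> E 1) = (l * measure lborel A) ^ n / fact n * exp (- (l * measure lborel A)) * exp (- (l * measure lborel B))"
      by (simp add: C_def k_def)
    moreover have "E 0 \<inter> E 1 = \<Phi> -` {\<phi> \<in> locally_finite_sets. card (\<phi> \<inter> A) = n \<and> \<phi> \<inter> B = {}} \<inter> space M"
      using lf AB by (auto simp: E_def C_def k_def locally_finiteD)
    moreover have "{\<phi> \<in> locally_finite_sets. card (\<phi> \<inter> A) = n \<and> \<phi> \<inter> B = {}} \<in> sets configurations"
    proof -
      have [measurable]: "(\<lambda>\<phi>. card (\<phi> \<inter> A)) \<in> measurable configurations (count_space UNIV)"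
        using AB by (intro measurable_card_Int) auto
      have "{\<phi> \<in> space configurations. card (\<phi> \<inter> A) = n} \<inter> void_event B \<in> sets configurations"
        using AB by (intro sets.Int void_event_sets) auto
      also have "{\<phi> \<in> space configurations. card (\<phi> \<inter> A) = n} \<inter> void_event B =
          {\<phi> \<in> locally_finite_sets. card (\<phi> \<inter> A) = n \<and> \<phi> \<inter> B = {}}"
        by (auto simp: space_configurations void_event_def)
      finally show ?thesis .
    qed
    ultimately show "measure (distr M configurations \<Phi>) {\<phi> \<in> locally_finite_sets. card (\<phi> \<inter> A) = n \<and> \<phi> \<inter> B = {}} =
        (l * measure lborel A) ^ n / fact n * exp (- (l * measure lborel A)) * exp (- (l * measure lborel B))"
      by (simp add: measure_distr)
  qed (use assms in auto)
qed

theorem lemma1: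
  fixes M :: "'w measure" and \<Phi> :: "'w \<Rightarrow> (real ^ 2) set" and l :: real
  assumes "prob_space M"
    and "l > 0"
    and "homogeneous_poisson_process M l \<Phi>"
  shows "\<forall>\<theta>. 0 < \<theta> \<and> \<theta> < 2 * pi \<longrightarrow>
    (let \<Psi> = (\<lambda>\<omega>. angle_points \<theta> (\<Phi> \<omega>)) in
       point_process M \<Psi> \<and> stationary M \<Psi> \<and> ergodic M \<Psi> \<and>
       intensity M \<Psi> = ennreal (2 * l * (sin (\<theta> / 2))\<^sup>2))"
proof (intro allI impI)
  fix \<theta> :: real assume "0 < \<theta> \<and> \<theta> < 2 * pi"
  then interpret angle \<theta> by unfold_locales auto
  have \<Phi> [measurable]: "\<Phi> \<in> measurable M configurations"
    using assms(3) by (auto simp: homogeneous_poisson_process_def point_process_def)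
  let ?P = "distr M configurations \<Phi>" and ?\<Psi> = "\<lambda>\<omega>. angle_points \<theta> (\<Phi> \<omega>)"
  interpret L: poisson_law ?P l by (rule poisson_law_distr[OF assms(2,3)])
  interpret poisson_angle ?P l \<theta> ..
  have \<Psi>: "?\<Psi> \<in> measurable M configurations" by measurable
  have distr_\<Psi>: "distr M configurations ?\<Psi> = distr ?P configurations (angle_points \<theta>)"
    by (subst distr_distr) (auto simp: o_def)
  have "distr M configurations (\<lambda>\<omega>. shift t (?\<Psi> \<omega>)) = distr M configurations ?\<Psi>" for t
  proof -
    have "distr M configurations (\<lambda>\<omega>. shift t (?\<Psi> \<omega>)) =
        distr (distr ?P configurations (shift t)) configurations (angle_points \<theta>)"
      by (simp add: distr_distr o_def angle_points_shift)
    then show ?thesis by (simp only: L.distr_shift distr_\<Psi>)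
  qed
  then have stat: "stationary M ?\<Psi>" by (simp add: stationary_def)
  have "measure (distr M configurations ?\<Psi>) E \<in> {0, 1}"
    if E: "E \<in> sets configurations" "\<forall>t. shift t ` E = E" for E
  proof -
    \<comment> \<open>Because \<open>angle_points \<theta>\<close> commutes with translations, this
      preimage is invariant as well, and triviality under the Poisson law applies to it.\<close>
    define E' where "E' = angle_points \<theta> -` E \<inter> locally_finite_sets"
    have E': "E' \<in> sets configurations"
      using measurable_sets[OF measurable_angle_points E(1)] by (simp add: E'_def space_configurations)
    have mem: "shift t \<phi> \<in> E" if "\<phi> \<in> E" for t \<phi> using E(2) that by blast
    have sub: "shift t ` E' \<subseteq> E'" for t
      using mem by (auto simp: E'_def angle_points_shift shift_locally_finite)
    have "shift t ` E' = E'" for t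
    proof
      \<comment> \<open>One inclusion for every translation yields equality, through the inverse
        translation.\<close>
      have "E' = shift t ` shift (- t) ` E'" by (simp add: image_image shift_shift)
      then show "E' \<subseteq> shift t ` E'" using sub[of "- t"] by blast
    qed (rule sub)
    then have "measure ?P E' \<in> {0, 1}" using E' by (intro L.shift_invariant_trivial)
    moreover have "measure (distr ?P configurations (angle_points \<theta>)) E = measure ?P (angle_points \<theta> -` E \<inter> space ?P)"
      using E(1) by (intro measure_distr) simp_all
    moreover have "angle_points \<theta> -` E \<inter> space ?P = E'"
      by (simp add: E'_def space_configurations)
    ultimately show ?thesis unfolding distr_\<Psi> by simp
  qed
  then have erg: "ergodic M ?\<Psi>" by (simp add: ergodic_def)
  have "(\<lambda>\<phi>. of_nat (card (angle_points \<theta> \<phi> \<inter> cbox 0 1)) :: ennreal) \<in> borel_measurable configurations"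
    by (intro measurable_compose[OF measurable_card_Int[OF measurable_angle_points]]) auto
  then have "intensity M ?\<Psi> = (\<integral>\<^sup>+\<phi>. of_nat (card (angle_points \<theta> \<phi> \<inter> cbox 0 1)) \<partial>?P)"
    unfolding intensity_def by (simp add: nn_integral_distr)
  then show "let \<Psi> = ?\<Psi> in point_process M \<Psi> \<and> stationary M \<Psi> \<and> ergodic M \<Psi> \<and>
      intensity M \<Psi> = ennreal (2 * l * (sin (\<theta> / 2))\<^sup>2)"
    using \<Psi> assms(1) stat erg nn_integral_card_angle_points by (simp add: Let_def point_process_def)
qed

end
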